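(* Let $n\ge1$, let $\sigma$ be a permutation of $\{1,\dots,n\}$ (priority list), let $T>0$, and let the coupled processes $\underline x(\cdot)$ (stirring) and $\underline x^0(\cdot)$ (coupled independent particles) start from a common labeled configuration $\underline x(0)=\underline x^0(0)$ of $n$ distinct sites of $\Lambda_N$. Then for any $\zeta>0$ and $k$ there is $c$ such that for all $0<t\le T$, all $\epsilon=1/N>0$ and every label $\ell\in\{1,\dots,n\}$, $$\mathbf P_\epsilon\big[|x_\ell(t)-x^0_\ell(t)|\ge(\epsilon^{-2}t)^{1/4+\zeta}\big]\le c(\epsilon^{-2}t)^{-k}.$$
   Context: $\Lambda_N=[-N,N]\cap\mathbb Z$, $\epsilon=1/N$. Active/passive marks process: for each pair $\{x,x+1\}$, $x\in\mathbb Z$, an independent Poisson process of intensity $\epsilon^{-2}$ of "marks", each mark independently "active" or "passive" with probability $1/2$; law $\mathbf P_\epsilon$. Stirring particles $\underline x(t)=(x_1(t),\dots,x_n(t))$: at an active mark at a pair $\{x,x+1\}\subset\Lambda_N$ the contents of $x$ and $x+1$ are exchanged; other marks have no effect on $\underline x$. Coupled process $\underline x^0(t)=(x_1^0(t),\dots,x^0_n(t))\in\Lambda_N^n$, defined from the same marks and the priority list $\sigma$ ($i$ has priority over $j$ iff $\sigma(i)<\sigma(j)$): $\underline x^0$ can change only at the time $t$ of a mark at a pair $\{x,x+1\}$ ($x\in\mathbb Z$) containing a site occupied by a stirring particle just before $t$. At such a time define $y\in\mathbb Z^n$ by $y=\underline x^0(t^-)$ except in the following cases. (a) $x,x+1\in\Lambda_N$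 and exactly one stirring particle, label $i$, is in $\{x,x+1\}$: if the mark is active, $y_i=x_i^0(t^-)+1$ if $x_i(t^-)=x$ and $y_i=x_i^0(t^-)-1$ if $x_i(t^-)=x+1$; if passive, no change. (b) $x,x+1\in\Lambda_N$ and two stirring particles $i,j$ occupy $\{x,x+1\}$ with $\sigma(i)<\sigma(j)$: if the mark is passive, $y_j=x^0_j(t^-)-[x_j(t^-)-x_i(t^-)]$; if active, $y_i=x^0_i(t^-)+[x_j(t^-)-x_i(t^-)]$. (c) $x=-N-1$ and $x_i(t^-)=-N$: if active, $y_i=x_i^0(t^-)-1$; if passive, no change. (d) $x=N$ and $x_i(t^-)=N$: if active, $y_i=x_i^0(t^-)+1$; if passive, no change. Then $\underline x^0(t)=y$ if $y\in\Lambda_N^n$, and $\underline x^0(t)=\underline x^0(t^-)$ otherwise. *)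

theory Defs
  imports "HOL-Probability.Probability"
begin

definition inLam :: "nat \<Rightarrow> int \<Rightarrow> bool" where
  "inLam N z \<longleftrightarrow> - int N \<le> z \<and> z \<le> int N"

text \<open>Marks: for each pair {x,x+1}, x an integer, a stream of (interarrival time, active?)
  pairs; interarrival times i.i.d. exponential with rate eps^(-2) = N^2, activity i.i.d.
  fair coin (True = active). Together this is a Poisson process of marks of intensity eps^(-2)
  with independent fair active/passive labels, independent over pairs.\<close>
definition marks_space :: "nat \<Rightarrow> (int \<Rightarrow> (real \<times> bool) stream) measure" where
  "marks_space N = (\<Pi>\<^sub>M x\<in>(UNIV::int set).
      stream_space (density lborel (exponential_density (real N ^ 2))
                    \<Otimes>\<^sub>M measure_pmf (bernoulli_pmf (1/2))))"

definition mark_time :: "(int \<Rightarrow> (real \<times> bool) stream) \<Rightarrow> int \<Rightarrow> nat \<Rightarrow> real" where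
  "mark_time \<omega> x k = (\<Sum>m\<le>k. fst (\<omega> x !! m))"

definition mark_active :: "(int \<Rightarrow> (real \<times> bool) stream) \<Rightarrow> int \<Rightarrow> nat \<Rightarrow> bool" where
  "mark_active \<omega> x k = snd (\<omega> x !! k)"

text \<open>All marks with time \<le> t at pairs {x,x+1} with x in [-N-1,N] (the only pairs that can
  contain a site of Lambda_N), as (time, x, active), sorted by time.  Marks at other pairs
  have no effect on either process.  (Ties and infinitely many marks are null events; the
  list order/empty-list conventions there are immaterial.)\<close>
definition marks_upto :: "nat \<Rightarrow> (int \<Rightarrow> (real \<times> bool) stream) \<Rightarrow> real \<Rightarrow> (real \<times> int \<times> bool) list" where
  "marks_upto N \<omega> t = sort_key fst
     (concat (map (\<lambda>x. map (\<lambda>k. (mark_time \<omega> x k, x, mark_active \<omega> x k))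
                          (sorted_list_of_set {k. mark_time \<omega> x k \<le> t}))
                  [- int N - 1 .. int N]))"

text \<open>Effect of a mark at pair {x,x+1} (active iff a) on the state (p, q), where p is the
  stirring configuration and q the coupled configuration, labels 1..n, priority sigma.\<close>
definition coupled_new :: "nat \<Rightarrow> nat \<Rightarrow> (nat \<Rightarrow> nat) \<Rightarrow> int \<Rightarrow> bool
    \<Rightarrow> (nat \<Rightarrow> int) \<Rightarrow> (nat \<Rightarrow> int) \<Rightarrow> (nat \<Rightarrow> int)" where
  "coupled_new N n \<sigma> x a p q =
    (let occ = {i \<in> {1..n}. p i = x \<or> p i = x + 1} in
     if occ = {} then q
     else if inLam N x \<and> inLam N (x + 1) then
       (if card occ = 1 then
          (let i = the_elem occ in
           if a then q(i := (if p i = x then q i + 1 else q i - 1)) else q)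
        else if card occ = 2 then
          (let i = arg_min_on \<sigma> occ; j = the_elem (occ - {i}); d = p j - p i in
           if a then q(i := q i + d) else q(j := q j - d))
        else q)
     else if x = - int N - 1 then
       (let i = the_elem occ in if a then q(i := q i - 1) else q)
     else if x = int N then
       (let i = the_elem occ in if a then q(i := q i + 1) else q)
     else q)"

definition mark_step :: "nat \<Rightarrow> nat \<Rightarrow> (nat \<Rightarrow> nat) \<Rightarrow> int \<Rightarrow> bool
    \<Rightarrow> (nat \<Rightarrow> int) \<times> (nat \<Rightarrow> int) \<Rightarrow> (nat \<Rightarrow> int) \<times> (nat \<Rightarrow> int)" where
  "mark_step N n \<sigma> x a pq =
    (let p = fst pq; q = snd pq;
         p' = (if a \<and> inLam N x \<and> inLam N (x + 1) then
                 (\<lambda>i. if p i = x then x + 1 else if p i = x + 1 then x else p i)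
               else p);
         y = coupled_new N n \<sigma> x a p q;
         q' = (if \<forall>i\<in>{1..n}. inLam N (y i) then y else q)
     in (p', q'))"

definition coupled_state :: "nat \<Rightarrow> nat \<Rightarrow> (nat \<Rightarrow> nat) \<Rightarrow> (nat \<Rightarrow> int)
    \<Rightarrow> (int \<Rightarrow> (real \<times> bool) stream) \<Rightarrow> real \<Rightarrow> (nat \<Rightarrow> int) \<times> (nat \<Rightarrow> int)" where
  "coupled_state N n \<sigma> z \<omega> t =
     fold (\<lambda>(s, x, a) st. mark_step N n \<sigma> x a st) (marks_upto N \<omega> t) (z, z)"

end

theory Submission
  imports Defs
begin

text \<open>
  The discrepancy $D = x_\ell - x^0_\ell$ changes by a centred step of size one only at marks on a
  pair occupied by $\ell$ and a particle of higher priority; every suppressed move brings $D$ closer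
  to $0$. With $\tau = \epsilon^{-2} t$ and $\theta = \tau^{-1/2}$, collisions are controlled by a
  bounded symmetric weight $g$ of the stirring configuration, a sum over pairs of
  $e^{-\theta |a - b|}$ plus exponential corrections at the walls: its generator is at most
  $C\theta^2$ minus a multiple of $\theta$ for each adjacent pair. Since
  $\cosh(\beta(D+1)) + \cosh(\beta(D-1)) = 2\cosh\beta \cosh(\beta D)$, the function
  $\cosh(\beta D)\, g$ with $\beta^2$ a small multiple of $\theta$ grows at most at rate
  $C\theta^2$ per unit of $\tau$, so its expectation stays bounded up to time $t$, and Markov's
  inequality at $|D| = \tau^{1/4+\zeta}$ gives a stretched exponential bound. The hypothesis
  $t \le T$ enters through $\theta N \ge T^{-1/2}$, which bounds the wall corrections.

  For the marks, no superposition theorem is needed: conditioning on the first mark, the remaining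
  marks have the original law by the memoryless property, and the growth bound follows by induction
  on the number of marks.
\<close>

section \<open>Decomposition of the marks at the first mark\<close>

text \<open>Why 1/4: heuristically, two stirring particles are adjacent for an amount of scaled time
  of order \<tau>^(1/2) up to time \<tau>, and the discrepancy makes fair unit steps at a constant
  rate during that time, so it has size \<tau>^(1/4). The obstacle is that the steps are not
  independent of the configuration: the coin that selects the sign of the step also decides whether
  the two stirring particles are exchanged. Symmetry removes it. An exchange only permutes the terms
  of the weight, so the weight has the same value for both outcomes and the coin averages the cosh
  factor alone. The weight plays the part of a local time. Each collision costs a factor cosh
  \<beta>, that is, a relative increase of order \<beta>^2; the kink of the distance term at contact
  pays an amount of order \<theta>. This forces \<beta>^2 to be at most of order \<theta>, while
  bounded growth up to time \<tau> forces \<theta>^2 \<tau> to stay bounded; the two constraints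
  together give the scale \<tau>^(1/4).\<close>

definition mark_word :: "nat \<Rightarrow> (int \<Rightarrow> (real \<times> bool) stream) \<Rightarrow> real \<Rightarrow> (int \<times> bool) list" where
  "mark_word N \<omega> t = map snd (marks_upto N \<omega> t)"

text \<open>The state depends on the order of the marks but not on their times. Words lie in a
  countable type, and a common time shift does not change them.\<close>

lemma coupled_state_mark_word:
  "coupled_state N n \<sigma> z \<omega> t = fold (\<lambda>(x, a). mark_step N n \<sigma> x a) (mark_word N \<omega> t) (z, z)"
  unfolding coupled_state_def mark_word_def fold_map
  by (simp add: comp_def case_prod_beta')

lemma insort_key_map: "insort_key f (g a) (map g xs) = map g (insort_key (\<lambda>v. f (g v)) a xs)"
  by (induction xs) auto

lemma sort_key_map: "sort_key f (map g xs) = map g (sort_key (\<lambda>v. f (g v)) xs)"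
  by (induction xs) (auto simp: insort_key_map)

lemma insort_key_add: "insort_key (\<lambda>v. c + f v) a xs = insort_key f a xs" for f :: "'a \<Rightarrow> real"
  by (induction xs) auto

lemma sort_key_add: "sort_key (\<lambda>v. c + f v) xs = sort_key f xs" for f :: "'a \<Rightarrow> real"
  by (induction xs) (auto simp: insort_key_add)

lemma insort_key_less:
  assumes "\<forall>v\<in>set xs. f e < f v" shows "insort_key f e xs = e # xs"
  using assms by (cases xs) auto

text \<open>Strictness matters: sorting is stable, so an entry of \<open>xs\<close> tied with
  \<open>e\<close> would stay ahead of it.\<close>

lemma sort_key_least:
  assumes "\<forall>v\<in>set xs \<union> set ys. f e < f v"
  shows "sort_key f (xs @ e # ys) = e # sort_key f (xs @ ys)"
  using assms
proof (induction xs)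
  case Nil
  then show ?case by (simp add: insort_key_less)
next
  case (Cons a xs)
  then show ?case by auto
qed

lemma sorted_list_of_set_insert_0_Suc:
  assumes "finite K"
  shows "sorted_list_of_set (insert 0 (Suc ` K)) = 0 # map Suc (sorted_list_of_set K)"
proof -
  have "sorted_list_of_set (set (0 # map Suc (sorted_list_of_set K))) = 0 # map Suc (sorted_list_of_set K)"
    by (subst sorted_list_of_set.idem_if_sorted_distinct)
       (auto simp: sorted_map distinct_map sorted_wrt_map assms)
  with assms show ?thesis by simp
qed

text \<open>Mark times are partial sums of gaps, so lengthening the first gap shifts all of them by
  the same amount.\<close>

definition delay :: "real \<Rightarrow> (real \<times> bool) stream \<Rightarrow> (real \<times> bool) stream" where
  "delay s w = (s + fst (shd w), snd (shd w)) ## stl w"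

text \<open>The environment in which the first mark is \<open>(s, x, a)\<close> and \<open>\<omega>\<close> is what happens afterwards.\<close>
definition first_mark :: "int set \<Rightarrow> real \<Rightarrow> int \<Rightarrow> bool \<Rightarrow> (int \<Rightarrow> (real \<times> bool) stream)
    \<Rightarrow> (int \<Rightarrow> (real \<times> bool) stream)" where
  "first_mark I s x a \<omega> =
     (\<lambda>y. if y = x then (s, a) ## \<omega> x else if y \<in> I then delay s (\<omega> y) else \<omega> y)"

lemma mark_time_0: "mark_time \<omega> x 0 = fst (shd (\<omega> x))"
  by (simp add: mark_time_def)

lemma mark_time_first_mark_0: "mark_time (first_mark I s x a \<omega>) x 0 = s"
  by (simp add: mark_time_def first_mark_def)

lemma mark_time_first_mark_Suc:
  "mark_time (first_mark I s x a \<omega>) x (Suc k) = s + mark_time \<omega> x k"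
  unfolding mark_time_def first_mark_def
  by (subst sum.atMost_Suc_shift) simp

lemma mark_time_first_mark_other:
  assumes "y \<noteq> x" "y \<in> I"
  shows "mark_time (first_mark I s x a \<omega>) y k = s + mark_time \<omega> y k"
proof -
  have "mark_time (first_mark I s x a \<omega>) y k = (\<Sum>m\<le>k. (if m = 0 then s else 0) + fst (\<omega> y !! m))"
    unfolding mark_time_def first_mark_def delay_def using assms
    by (intro sum.cong refl) (auto simp: Stream_snth split: nat.splits)
  then show ?thesis by (simp add: mark_time_def sum.distrib)
qed

lemma mark_active_first_mark_0: "mark_active (first_mark I s x a \<omega>) x 0 = a"
  by (simp add: mark_active_def first_mark_def)

lemma mark_active_first_mark_Suc: "mark_active (first_mark I s x a \<omega>) x (Suc k) = mark_active \<omega> x k"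
  by (simp add: mark_active_def first_mark_def)

lemma mark_active_first_mark_other:
  assumes "y \<noteq> x"
  shows "mark_active (first_mark I s x a \<omega>) y k = mark_active \<omega> y k"
  using assms by (cases k) (auto simp: mark_active_def first_mark_def delay_def)

definition site_marks :: "(int \<Rightarrow> (real \<times> bool) stream) \<Rightarrow> real \<Rightarrow> int \<Rightarrow> (real \<times> int \<times> bool) list" where
  "site_marks \<omega> t x = map (\<lambda>k. (mark_time \<omega> x k, x, mark_active \<omega> x k))
      (sorted_list_of_set {k. mark_time \<omega> x k \<le> t})"

text \<open>On an infinite index set \<open>sorted_list_of_set\<close> returns the empty list, so
  without finiteness the prepended mark would be lost.\<close>

lemma site_marks_first_mark:
  assumes "finite {k. mark_time \<omega> x k \<le> t - s}" "s \<le> t"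
  shows "site_marks (first_mark I s x a \<omega>) t x =
    (s, x, a) # map (\<lambda>(u, v). (s + u, v)) (site_marks \<omega> (t - s) x)"
proof -
  have "{k. mark_time (first_mark I s x a \<omega>) x k \<le> t} = insert 0 (Suc ` {k. mark_time \<omega> x k \<le> t - s})"
  proof (intro set_eqI)
    fix k show "k \<in> {k. mark_time (first_mark I s x a \<omega>) x k \<le> t} \<longleftrightarrow>
       k \<in> insert 0 (Suc ` {k. mark_time \<omega> x k \<le> t - s})"
      using assms(2) by (cases k) (auto simp: mark_time_first_mark_0 mark_time_first_mark_Suc algebra_simps)
  qed
  then show ?thesis
    unfolding site_marks_def
    by (simp add: sorted_list_of_set_insert_0_Suc[OF assms(1)] mark_time_first_mark_0
        mark_active_first_mark_0 mark_time_first_mark_Suc mark_active_first_mark_Suc)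
qed

lemma site_marks_first_mark_other:
  assumes "y \<noteq> x" "y \<in> I"
  shows "site_marks (first_mark I s x a \<omega>) t y = map (\<lambda>(u, v). (s + u, v)) (site_marks \<omega> (t - s) y)"
proof -
  have "{k. mark_time (first_mark I s x a \<omega>) y k \<le> t} = {k. mark_time \<omega> y k \<le> t - s}"
    using assms by (auto simp: mark_time_first_mark_other algebra_simps)
  then show ?thesis
    unfolding site_marks_def using assms
    by (simp add: mark_time_first_mark_other mark_active_first_mark_other)
qed

lemma marks_upto_site_marks:
  "marks_upto N \<omega> t = sort_key fst (concat (map (site_marks \<omega> t) [- int N - 1 .. int N]))"
  unfolding marks_upto_def site_marks_def ..

text \<open>Positive gaps place every other mark strictly after the first one, and local finiteness
  keeps the index lists away from their default value. Both hold almost surely.\<close>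

definition regular_marks :: "(int \<Rightarrow> (real \<times> bool) stream) \<Rightarrow> bool" where
  "regular_marks \<omega> \<longleftrightarrow> (\<forall>x k. 0 < fst (\<omega> x !! k)) \<and> (\<forall>x t. finite {k. mark_time \<omega> x k \<le> t})"

lemma regular_marks_mark_time_pos: "regular_marks \<omega> \<Longrightarrow> 0 < mark_time \<omega> x k"
  unfolding regular_marks_def mark_time_def by (intro sum_pos) auto

text \<open>All marks of the window other than the new one are shifted by \<open>s\<close>, which
  sorting does not notice; since their original times are positive, they come strictly after the new
  mark. This is the recursion on which the later induction rests.\<close>

lemma mark_word_first_mark:
  assumes "regular_marks \<omega>" "s \<le> t" and x: "x \<in> {- int N - 1 .. int N}"
  shows "mark_word N (first_mark {- int N - 1 .. int N} s x a \<omega>) t = (x, a) # mark_word N \<omega> (t - s)"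
proof -
  let ?F = "first_mark {- int N - 1 .. int N} s x a \<omega>" and ?g = "\<lambda>(u, v). (s + u, v) :: real \<times> int \<times> bool"
  obtain xs ys where xy: "[- int N - 1 .. int N] = xs @ x # ys"
    using x split_list[of x "[- int N - 1 .. int N]"] by auto
  have "distinct [- int N - 1 .. int N]" "set [- int N - 1 .. int N] = {- int N - 1 .. int N}"
    by simp_all
  then have d: "x \<notin> set xs" "x \<notin> set ys" "set xs \<subseteq> {- int N - 1 .. int N}" "set ys \<subseteq> {- int N - 1 .. int N}"
    unfolding xy by auto
  define A where "A = concat (map (site_marks \<omega> (t - s)) xs)"
  define B where "B = concat (map (site_marks \<omega> (t - s)) (x # ys))"
  have sm: "map (site_marks ?F t) zs = map (\<lambda>y. map ?g (site_marks \<omega> (t - s) y)) zs"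
    if "x \<notin> set zs" "set zs \<subseteq> {- int N - 1 .. int N}" for zs
    using that by (intro map_cong refl site_marks_first_mark_other) auto
  have "concat (map (site_marks ?F t) [- int N - 1 .. int N]) = map ?g A @ (s, x, a) # map ?g B"
    unfolding xy A_def B_def using assms(1) d
    by (simp add: sm site_marks_first_mark[OF _ assms(2)] regular_marks_def map_concat comp_def)
  moreover have "sort_key fst (map ?g A @ (s, x, a) # map ?g B) = (s, x, a) # sort_key fst (map ?g A @ map ?g B)"
    using regular_marks_mark_time_pos[OF assms(1)]
    by (intro sort_key_least) (auto simp: A_def B_def site_marks_def)
  moreover have "sort_key fst (map ?g A @ map ?g B) = map ?g (sort_key fst (A @ B))"
    unfolding map_append[symmetric] sort_key_map
    using sort_key_add[of s fst "A @ B"] by (simp add: case_prod_beta)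
  ultimately have "marks_upto N ?F t = (s, x, a) # map ?g (sort_key fst (A @ B))"
    by (simp add: marks_upto_site_marks)
  moreover have "A @ B = concat (map (site_marks \<omega> (t - s)) [- int N - 1 .. int N])"
    unfolding xy A_def B_def by simp
  ultimately show ?thesis
    by (simp add: mark_word_def marks_upto_site_marks comp_def case_prod_beta)
qed

lemma mark_word_Nil:
  assumes "regular_marks \<omega>" "\<forall>x\<in>{- int N - 1 .. int N}. t < fst (shd (\<omega> x))"
  shows "mark_word N \<omega> t = []"
proof -
  have "{k. mark_time \<omega> x k \<le> t} = {}" if "x \<in> {- int N - 1 .. int N}" for x
  proof -
    have "mark_time \<omega> x 0 \<le> mark_time \<omega> x k" for k
      unfolding mark_time_def using assms(1)
      by (intro sum_mono2) (auto simp: regular_marks_def intro: less_imp_le)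
    moreover have "t < mark_time \<omega> x 0" using assms(2) that by (simp add: mark_time_0)
    ultimately have "t < mark_time \<omega> x k" for k by (meson less_le_trans)
    then show ?thesis by (auto simp: not_le)
  qed
  then have "concat (map (site_marks \<omega> t) [- int N - 1 .. int N]) = []"
    by (auto simp: site_marks_def)
  then show ?thesis
    by (simp only: mark_word_def marks_upto_site_marks) simp
qed

section \<open>Measurability of list-valued functions of the marks\<close>

lemma measurable_insort_key:
  fixes f :: "'b \<Rightarrow> 'a::countable \<Rightarrow> real"
  assumes [measurable]: "\<And>i. (\<lambda>\<omega>. f \<omega> i) \<in> borel_measurable M"
  shows "(\<lambda>\<omega>. insort_key (f \<omega>) a xs) \<in> measurable M (count_space UNIV)"
proof (induction xs)
  case (Cons b xs)
  note Cons[measurable]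
  show ?case by simp
qed simp

text \<open>Both the keys and the sorted tail depend on \<omega>. The tail takes countably many
  values, so it can be fixed while the insertion is examined.\<close>

lemma measurable_sort_key:
  fixes f :: "'b \<Rightarrow> 'a::countable \<Rightarrow> real"
  assumes "\<And>i. (\<lambda>\<omega>. f \<omega> i) \<in> borel_measurable M"
  shows "(\<lambda>\<omega>. sort_key (f \<omega>) xs) \<in> measurable M (count_space UNIV)"
proof (induction xs)
  case (Cons b xs)
  then show ?case
    using measurable_compose_countable[OF measurable_insort_key[OF assms] Cons] by simp
qed simp

lemma measurable_map_count_space:
  fixes f :: "'b \<Rightarrow> 'a \<Rightarrow> 'c::countable"
  assumes [measurable]: "\<And>i. (\<lambda>\<omega>. f \<omega> i) \<in> measurable M (count_space UNIV)"
  shows "(\<lambda>\<omega>. map (f \<omega>) xs) \<in> measurable M (count_space UNIV)"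
proof (induction xs)
  case (Cons b xs)
  note Cons[measurable]
  show ?case by simp
qed simp

lemma measurable_concat_map:
  fixes f :: "'b \<Rightarrow> 'a \<Rightarrow> 'c::countable list"
  assumes [measurable]: "\<And>i. (\<lambda>\<omega>. f \<omega> i) \<in> measurable M (count_space UNIV)"
  shows "(\<lambda>\<omega>. concat (map (f \<omega>) xs)) \<in> measurable M (count_space UNIV)"
proof (induction xs)
  case (Cons b xs)
  note Cons[measurable]
  show ?case by simp
qed simp

lemma measurable_sorted_list_of_Collect:
  assumes [measurable]: "\<And>k. Measurable.pred M (\<lambda>\<omega>. P \<omega> (k::nat))"
  shows "(\<lambda>\<omega>. sorted_list_of_set {k. P \<omega> k}) \<in> measurable M (count_space UNIV)"
proof (subst measurable_count_space_eq2_countable, safe)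
  fix L :: "nat list"
  \<comment> \<open>The fibre over the empty list contains the infinite index sets as well as the
    empty one. A nonempty list determines its index set, and has an empty fibre unless it is sorted
    and distinct.\<close>
  have "(sorted_list_of_set {k. P \<omega> k} = L) \<longleftrightarrow>
     (if L = [] then (\<forall>k. \<not> P \<omega> k) \<or> infinite {k. P \<omega> k}
      else sorted_list_of_set (set L) = L \<and> (\<forall>k. P \<omega> k \<longleftrightarrow> k \<in> set L))" for \<omega>
  proof (cases "L = []")
    case True
    then show ?thesis by (auto simp: sorted_list_of_set_eq_Nil_iff)
  next
    case False
    have "{k. P \<omega> k} = set L" if "sorted_list_of_set {k. P \<omega> k} = L"
      using that False by (cases "finite {k. P \<omega> k}") auto
    with False show ?thesis by auto
  qed
  moreover have "Measurable.pred M (\<lambda>\<omega>. infinite {k. P \<omega> k})"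
    unfolding infinite_nat_iff_unbounded by simp
  ultimately show "(\<lambda>\<omega>. sorted_list_of_set {k. P \<omega> k}) -` {L} \<inter> space M \<in> sets M"
    by (simp add: vimage_def Int_def conj_commute) measurable
qed auto

section \<open>The law of the marks\<close>

definition mark_law :: "real \<Rightarrow> (real \<times> bool) measure" where
  "mark_law r = density lborel (exponential_density r) \<Otimes>\<^sub>M measure_pmf (bernoulli_pmf (1/2))"

definition env_space :: "real \<Rightarrow> (int \<Rightarrow> (real \<times> bool) stream) measure" where
  "env_space r = (\<Pi>\<^sub>M x\<in>UNIV. stream_space (mark_law r))"

lemma marks_space_env_space: "marks_space N = env_space (real N ^ 2)"
  by (simp add: marks_space_def env_space_def mark_law_def)

lemma sets_mark_law [measurable_cong]: "sets (mark_law r) = sets (borel \<Otimes>\<^sub>M count_space UNIV)"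
  unfolding mark_law_def by (intro sets_pair_measure_cong) auto

lemma space_mark_law [simp]: "space (mark_law r) = UNIV"
  by (simp add: mark_law_def space_pair_measure)

lemma prob_space_mark_law: "0 < r \<Longrightarrow> prob_space (mark_law r)"
  unfolding mark_law_def
  by (intro prob_space_pair prob_space_exponential_density prob_space_measure_pmf)

lemma prob_space_stream_mark_law: "0 < r \<Longrightarrow> prob_space (stream_space (mark_law r))"
  by (intro prob_space.prob_space_stream_space prob_space_mark_law)

lemma prob_space_env_space: "0 < r \<Longrightarrow> prob_space (env_space r)"
  unfolding env_space_def by (intro prob_space_PiM prob_space_stream_mark_law)

lemma space_env_space [simp]: "space (env_space r) = UNIV"
  by (auto simp: env_space_def space_PiM space_stream_space)

lemma measurable_env_component [measurable]:
  "(\<lambda>\<omega>. \<omega> x) \<in> measurable (env_space r) (stream_space (mark_law r))"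
  unfolding env_space_def by measurable

lemma measurable_env_component' [measurable (raw)]:
  assumes "f \<in> measurable M (env_space r)"
  shows "(\<lambda>w. f w x) \<in> measurable M (stream_space (mark_law r))"
  using measurable_compose[OF assms measurable_env_component] .

lemma measurable_mark:
  "(\<lambda>\<omega>. \<omega> x !! k) \<in> measurable (env_space r) (borel \<Otimes>\<^sub>M count_space UNIV)"
  using measurable_compose[OF measurable_env_component measurable_snth]
  unfolding measurable_cong_sets[OF refl sets_mark_law] .

lemma measurable_mark_time [measurable]: "(\<lambda>\<omega>. mark_time \<omega> x k) \<in> borel_measurable (env_space r)"
  unfolding mark_time_def
  by (intro borel_measurable_sum measurable_compose[OF measurable_mark] measurable_fst)

lemma measurable_mark_active [measurable]:
  "(\<lambda>\<omega>. mark_active \<omega> x k) \<in> measurable (env_space r) (count_space UNIV)"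
  unfolding mark_active_def
  by (intro measurable_compose[OF measurable_mark] measurable_snd)

text \<open>Sorting index pairs by their times, instead of timed marks, keeps every list in a
  countable type; the real times enter only as keys.\<close>

lemma measurable_mark_word [measurable]:
  "(\<lambda>\<omega>. mark_word N \<omega> t) \<in> measurable (env_space r) (count_space UNIV)"
proof -
  let ?key = "\<lambda>\<omega> (x, k). mark_time \<omega> x k"
  define C where "C \<omega> = concat (map (\<lambda>x. map (Pair x) (sorted_list_of_set {k. mark_time \<omega> x k \<le> t}))
     [- int N - 1 .. int N])" for \<omega>
  have 1: "C \<in> measurable (env_space r) (count_space UNIV)"
    unfolding C_def
    by (intro measurable_concat_map measurable_compose[OF measurable_sorted_list_of_Collect]) auto
  have 2: "(\<lambda>\<omega>. sort_key (?key \<omega>) (C \<omega>)) \<in> measurable (env_space r) (count_space UNIV)"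
    by (rule measurable_compose_countable[OF measurable_sort_key 1]) (auto simp: case_prod_beta)
  have 3: "(\<lambda>\<omega>. map (\<lambda>(x, k). (x, mark_active \<omega> x k)) (sort_key (?key \<omega>) (C \<omega>)))
     \<in> measurable (env_space r) (count_space UNIV)"
    by (rule measurable_compose_countable[OF measurable_map_count_space 2])
       (auto simp: case_prod_beta)
  have "mark_word N \<omega> t = map (\<lambda>(x, k). (x, mark_active \<omega> x k)) (sort_key (?key \<omega>) (C \<omega>))" for \<omega>
  proof -
    have "concat (map (site_marks \<omega> t) [- int N - 1 .. int N]) =
       map (\<lambda>(x, k). (mark_time \<omega> x k, x, mark_active \<omega> x k)) (C \<omega>)"
      by (simp add: C_def site_marks_def[abs_def] map_concat comp_def)
    then show ?thesis
      by (simp add: mark_word_def marks_upto_site_marks sort_key_map comp_def case_prod_beta')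
  qed
  with 3 show ?thesis by simp
qed

section \<open>The memoryless property\<close>

lemma measurable_env_space:
  assumes "\<And>x. (\<lambda>w. f w x) \<in> measurable M (stream_space (mark_law r))"
  shows "f \<in> measurable M (env_space r)"
  unfolding env_space_def using assms
  by (intro measurable_PiM_single') (auto simp: space_stream_space)

lemma measurable_delay [measurable (raw)]:
  assumes [measurable]: "f \<in> borel_measurable M" "g \<in> measurable M (stream_space (mark_law r))"
  shows "(\<lambda>w. delay (f w) (g w)) \<in> measurable M (stream_space (mark_law r))"
proof -
  have [measurable]: "(\<lambda>w. shd (g w)) \<in> measurable M (borel \<Otimes>\<^sub>M count_space UNIV)"
    using measurable_compose[OF assms(2) measurable_shd]
    unfolding measurable_cong_sets[OF refl sets_mark_law] .
  have [measurable]: "(\<lambda>w. (f w + fst (shd (g w)), snd (shd (g w)))) \<in> measurable M (mark_law r)"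
    by measurable
  show ?thesis
    unfolding delay_def by measurable
qed

lemma measurable_fst_shd [measurable (raw)]:
  assumes [measurable]: "g \<in> measurable M (stream_space (mark_law r))"
  shows "(\<lambda>w. fst (shd (g w))) \<in> borel_measurable M"
proof -
  have [measurable]: "(\<lambda>w. shd (g w)) \<in> measurable M (borel \<Otimes>\<^sub>M count_space UNIV)"
    using measurable_compose[OF assms(1) measurable_shd]
    unfolding measurable_cong_sets[OF refl sets_mark_law] .
  show ?thesis by measurable
qed

lemma measurable_first_mark [measurable (raw)]:
  assumes [measurable]: "f \<in> borel_measurable M" "g \<in> measurable M (count_space UNIV)"
    "h \<in> measurable M (env_space r)"
  shows "(\<lambda>w. first_mark I (f w) x (g w) (h w)) \<in> measurable M (env_space r)"
proof (rule measurable_env_space)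
  fix y
  show "(\<lambda>w. first_mark I (f w) x (g w) (h w) y) \<in> measurable M (stream_space (mark_law r))"
    unfolding first_mark_def by measurable
qed

text \<open>One coordinate of a product law may be replaced by an independent copy. In this form
  Fubini's theorem isolates a single stream while the environment stays indexed by all of the
  integers.\<close>

lemma nn_integral_env_resample:
  assumes r: "0 < r" and [measurable]: "f \<in> borel_measurable (env_space r)"
  shows "(\<integral>\<^sup>+\<omega>. f \<omega> \<partial>env_space r) =
    (\<integral>\<^sup>+\<omega>. (\<integral>\<^sup>+w. f (\<omega> (y := w)) \<partial>stream_space (mark_law r)) \<partial>env_space r)"
proof -
  let ?S = "stream_space (mark_law r)"
  interpret S: prob_space ?S by (rule prob_space_stream_mark_law[OF r])
  interpret P: prob_space "env_space r" by (rule prob_space_env_space[OF r])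
  interpret SP: pair_sigma_finite ?S "env_space r" ..
  have [measurable]: "(\<lambda>(w, \<omega>). \<omega> (y := w)) \<in> measurable (?S \<Otimes>\<^sub>M env_space r) (env_space r)"
    by (rule measurable_env_space) (auto simp: case_prod_beta)
  have "env_space r = distr (?S \<Otimes>\<^sub>M env_space r) (env_space r) (\<lambda>(w, \<omega>). \<omega> (y := w))"
    unfolding env_space_def
    using distr_pair_PiM_eq_PiM[of "UNIV :: int set" "\<lambda>_. ?S" y] S.prob_space_axioms by simp
  then have "(\<integral>\<^sup>+\<omega>. f \<omega> \<partial>env_space r) =
      (\<integral>\<^sup>+\<omega>. f \<omega> \<partial>distr (?S \<Otimes>\<^sub>M env_space r) (env_space r) (\<lambda>(w, \<omega>). \<omega> (y := w)))"
    by simp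
  also have "\<dots> = (\<integral>\<^sup>+v. f ((snd v)(y := fst v)) \<partial>(?S \<Otimes>\<^sub>M env_space r))"
    by (subst nn_integral_distr) (auto simp: case_prod_beta)
  also have "\<dots> = (\<integral>\<^sup>+\<omega>. (\<integral>\<^sup>+w. f (\<omega> (y := w)) \<partial>?S) \<partial>env_space r)"
    by (subst SP.nn_integral_snd[symmetric]) (auto simp: case_prod_beta)
  finally show ?thesis .
qed

lemma nn_integral_mark_stream:
  assumes r: "0 < r" and [measurable]: "f \<in> borel_measurable (stream_space (mark_law r))"
  shows "(\<integral>\<^sup>+w. f w \<partial>stream_space (mark_law r)) =
    (\<integral>\<^sup>+s. (\<integral>\<^sup>+a. (\<integral>\<^sup>+w. f ((s, a) ## w) \<partial>stream_space (mark_law r)) \<partial>measure_pmf (bernoulli_pmf (1/2)))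
      \<partial>density lborel (exponential_density r))"
proof -
  interpret S: prob_space "stream_space (mark_law r)" by (rule prob_space_stream_mark_law[OF r])
  interpret E: prob_space "density lborel (exponential_density r)"
    by (rule prob_space_exponential_density[OF r])
  interpret EB: pair_sigma_finite "density lborel (exponential_density r)" "measure_pmf (bernoulli_pmf (1/2))" ..
  have [measurable]: "(\<lambda>v. \<integral>\<^sup>+w. f (v ## w) \<partial>stream_space (mark_law r))
      \<in> borel_measurable (mark_law r)"
    by measurable
  then have [measurable]: "(\<lambda>v. \<integral>\<^sup>+w. f (v ## w) \<partial>stream_space (mark_law r)) \<in> borel_measurable
      (density lborel (exponential_density r) \<Otimes>\<^sub>M measure_pmf (bernoulli_pmf (1/2)))"
    by (simp add: mark_law_def)
  show ?thesis
    by (subst prob_space.nn_integral_stream_space[OF prob_space_mark_law[OF r]], measurable)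
       (subst mark_law_def, subst measure_pmf.nn_integral_fst[symmetric], auto)
qed

text \<open>After the substitution, the density at \<open>s + u\<close> factors as exp(-rs) times
  the density at \<open>u\<close> for nonnegative \<open>u\<close>; for negative \<open>u\<close>
  both sides vanish.\<close>

lemma nn_integral_exponential_memoryless:
  assumes r: "0 < r" and s: "0 \<le> s" and [measurable]: "f \<in> borel_measurable borel"
  shows "(\<integral>\<^sup>+u. f u * indicator {s..} u \<partial>density lborel (exponential_density r)) =
    ennreal (exp (- r * s)) * (\<integral>\<^sup>+u. f (s + u) \<partial>density lborel (exponential_density r))"
proof -
  have "(\<integral>\<^sup>+u. f u * indicator {s..} u \<partial>density lborel (exponential_density r)) =
     (\<integral>\<^sup>+u. ennreal (exponential_density r u) * (f u * indicator {s..} u) \<partial>lborel)"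
    by (subst nn_integral_density) auto
  also have "\<dots> = (\<integral>\<^sup>+u. ennreal (exponential_density r (s + u)) * (f (s + u) * indicator {s..} (s + u)) \<partial>lborel)"
    by (subst nn_integral_real_affine[where c = 1 and t = s]) auto
  also have "\<dots> = (\<integral>\<^sup>+u. ennreal (exp (- r * s)) * (ennreal (exponential_density r u) * f (s + u)) \<partial>lborel)"
  proof (intro nn_integral_cong)
    fix u :: real
    show "ennreal (exponential_density r (s + u)) * (f (s + u) * indicator {s..} (s + u)) =
        ennreal (exp (- r * s)) * (ennreal (exponential_density r u) * f (s + u))"
    proof (cases "0 \<le> u")
      case True
      then have "exponential_density r (s + u) = exp (- r * s) * exponential_density r u"
        using s by (simp add: exponential_density_def exp_add[symmetric] algebra_simps)
      then show ?thesis using True r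
        by (simp add: ennreal_mult' exponential_density_nonneg mult.assoc)
    qed (simp add: exponential_density_def)
  qed
  also have "\<dots> = ennreal (exp (- r * s)) * (\<integral>\<^sup>+u. f (s + u) \<partial>density lborel (exponential_density r))"
    by (subst nn_integral_cmult) (auto simp: nn_integral_density)
  finally show ?thesis .
qed

lemma nn_integral_delay:
  assumes r: "0 < r" and s: "0 \<le> s" and [measurable]: "f \<in> borel_measurable (stream_space (mark_law r))"
  shows "(\<integral>\<^sup>+w. f w * indicator {w. s \<le> fst (shd w)} w \<partial>stream_space (mark_law r)) =
    ennreal (exp (- r * s)) * (\<integral>\<^sup>+w. f (delay s w) \<partial>stream_space (mark_law r))"
proof -
  interpret S: prob_space "stream_space (mark_law r)" by (rule prob_space_stream_mark_law[OF r])
  have [measurable]: "(\<lambda>u. \<integral>\<^sup>+a. (\<integral>\<^sup>+w. f ((u, a) ## w) \<partial>stream_space (mark_law r)) \<partial>measure_pmf (bernoulli_pmf (1/2)))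
      \<in> borel_measurable borel"
    by measurable
  have [measurable]: "{w. s \<le> fst (shd w)} \<in> sets (stream_space (mark_law r))"
  proof -
    have "{w \<in> space (stream_space (mark_law r)). s \<le> fst (shd w)} \<in> sets (stream_space (mark_law r))"
      by measurable
    then show ?thesis by (simp add: space_stream_space)
  qed
  have "(\<integral>\<^sup>+w. f w * indicator {w. s \<le> fst (shd w)} w \<partial>stream_space (mark_law r)) =
    (\<integral>\<^sup>+u. (\<integral>\<^sup>+a. (\<integral>\<^sup>+w. f ((u, a) ## w) \<partial>stream_space (mark_law r)) \<partial>measure_pmf (bernoulli_pmf (1/2)))
        * indicator {s..} u \<partial>density lborel (exponential_density r))"
    by (subst nn_integral_mark_stream[OF r]) (auto intro!: nn_integral_cong simp: indicator_def)
  also have "\<dots> = ennreal (exp (- r * s)) *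
    (\<integral>\<^sup>+u. (\<integral>\<^sup>+a. (\<integral>\<^sup>+w. f ((s + u, a) ## w) \<partial>stream_space (mark_law r)) \<partial>measure_pmf (bernoulli_pmf (1/2)))
      \<partial>density lborel (exponential_density r))"
    by (subst nn_integral_exponential_memoryless[OF r s]) auto
  also have "(\<integral>\<^sup>+u. (\<integral>\<^sup>+a. (\<integral>\<^sup>+w. f ((s + u, a) ## w) \<partial>stream_space (mark_law r)) \<partial>measure_pmf (bernoulli_pmf (1/2)))
      \<partial>density lborel (exponential_density r)) = (\<integral>\<^sup>+w. f (delay s w) \<partial>stream_space (mark_law r))"
    by (subst (2) nn_integral_mark_stream[OF r]) (auto simp: delay_def)
  finally show ?thesis .
qed

definition delay_on :: "int set \<Rightarrow> real \<Rightarrow> (int \<Rightarrow> (real \<times> bool) stream) \<Rightarrow> (int \<Rightarrow> (real \<times> bool) stream)" where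
  "delay_on J s \<omega> = (\<lambda>y. if y \<in> J then delay s (\<omega> y) else \<omega> y)"

lemma measurable_delay_on [measurable]: "delay_on J s \<in> measurable (env_space r) (env_space r)"
proof (rule measurable_env_space)
  fix y show "(\<lambda>\<omega>. delay_on J s \<omega> y) \<in> measurable (env_space r) (stream_space (mark_law r))"
    unfolding delay_on_def by (cases "y \<in> J") simp_all
qed

lemma measurable_env_upd:
  "(\<lambda>w. fun_upd \<omega> j w) \<in> measurable (stream_space (mark_law r)) (env_space r)"
proof (rule measurable_env_space)
  fix y show "(\<lambda>w. fun_upd \<omega> j w y) \<in> measurable (stream_space (mark_law r)) (stream_space (mark_law r))"
    by (cases "y = j") (simp_all add: space_stream_space)
qed

lemma sets_first_ge [measurable]: "{\<omega>. s \<le> fst (shd (\<omega> j))} \<in> sets (env_space r)"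
proof -
  have "{\<omega> \<in> space (env_space r). s \<le> fst (shd (\<omega> j))} \<in> sets (env_space r)"
    by measurable
  then show ?thesis by simp
qed

text \<open>Given that none of these streams has a mark before \<open>s\<close>, their futures after
  \<open>s\<close> are again fresh. The streams are independent, so each contributes its own factor
  exp(-rs), and they can be treated one at a time.\<close>

lemma nn_integral_delay_many:
  assumes r: "0 < r" and s: "0 \<le> s" and J: "finite J" and "f \<in> borel_measurable (env_space r)"
  shows "(\<integral>\<^sup>+\<omega>. f \<omega> * indicator {\<omega>. \<forall>y\<in>J. s \<le> fst (shd (\<omega> y))} \<omega> \<partial>env_space r) =
    ennreal (exp (- r * s * card J)) * (\<integral>\<^sup>+\<omega>. f (delay_on J s \<omega>) \<partial>env_space r)"
  using J assms(4)
proof (induction J arbitrary: f)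
  case empty
  then show ?case by (simp add: delay_on_def)
next
  case (insert j J)
  note [measurable] = insert.prems
  let ?S = "stream_space (mark_law r)" and ?E = "{\<omega>. s \<le> fst (shd (\<omega> j))}"
  have upd: "delay_on J s (fun_upd \<omega> j (delay s w)) = delay_on (insert j J) s (fun_upd \<omega> j w)" for \<omega> w
    using insert.hyps by (auto simp: delay_on_def)
  \<comment> \<open>The delay on \<open>J\<close> does not touch coordinate \<open>j\<close>, so the
    constraint on \<open>j\<close> passes through the induction hypothesis unchanged.\<close>
  have same: "delay_on J s \<omega> \<in> ?E \<longleftrightarrow> \<omega> \<in> ?E" for \<omega>
    using insert.hyps by (simp add: delay_on_def)
  have m1: "(\<lambda>\<omega>. f \<omega> * indicator ?E \<omega>) \<in> borel_measurable (env_space r)"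
    by measurable
  have m2: "(\<lambda>\<omega>. f (delay_on J s \<omega>) * indicator ?E \<omega>) \<in> borel_measurable (env_space r)"
    by measurable
  have m3: "(\<lambda>\<omega>. f (delay_on K s \<omega>)) \<in> borel_measurable (env_space r)" for K
    by measurable
  have m4: "(\<lambda>w. f (delay_on K s (fun_upd \<omega> j w))) \<in> borel_measurable ?S" for \<omega> K
    by (rule measurable_compose[OF measurable_env_upd m3])
  have "(\<integral>\<^sup>+\<omega>. f \<omega> * indicator {\<omega>. \<forall>y\<in>insert j J. s \<le> fst (shd (\<omega> y))} \<omega> \<partial>env_space r) =
     (\<integral>\<^sup>+\<omega>. (f \<omega> * indicator ?E \<omega>) * indicator {\<omega>. \<forall>y\<in>J. s \<le> fst (shd (\<omega> y))} \<omega> \<partial>env_space r)"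
    by (intro nn_integral_cong) (auto simp: indicator_def)
  also have "\<dots> = ennreal (exp (- r * s * card J)) *
      (\<integral>\<^sup>+\<omega>. f (delay_on J s \<omega>) * indicator ?E (delay_on J s \<omega>) \<partial>env_space r)"
    by (rule insert.IH[OF m1])
  also have "(\<integral>\<^sup>+\<omega>. f (delay_on J s \<omega>) * indicator ?E (delay_on J s \<omega>) \<partial>env_space r) =
     (\<integral>\<^sup>+\<omega>. f (delay_on J s \<omega>) * indicator ?E \<omega> \<partial>env_space r)"
    using same by (simp add: indicator_def)
  also have "\<dots> = (\<integral>\<^sup>+\<omega>. \<integral>\<^sup>+w. f (delay_on J s (fun_upd \<omega> j w)) * indicator ?E (fun_upd \<omega> j w) \<partial>?S \<partial>env_space r)"
    by (rule nn_integral_env_resample[OF r m2])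
  also have "\<dots> = (\<integral>\<^sup>+\<omega>. \<integral>\<^sup>+w. f (delay_on J s (fun_upd \<omega> j w)) * indicator {w. s \<le> fst (shd w)} w \<partial>?S \<partial>env_space r)"
    by (simp add: indicator_def)
  also have "\<dots> = (\<integral>\<^sup>+\<omega>. ennreal (exp (- r * s)) * (\<integral>\<^sup>+w. f (delay_on (insert j J) s (fun_upd \<omega> j w)) \<partial>?S) \<partial>env_space r)"
    by (simp only: nn_integral_delay[OF r s m4] upd)
  also have "\<dots> = (\<integral>\<^sup>+\<omega>. \<integral>\<^sup>+w. ennreal (exp (- r * s)) * f (delay_on (insert j J) s (fun_upd \<omega> j w)) \<partial>?S \<partial>env_space r)"
    by (simp only: nn_integral_cmult[OF m4])
  also have "\<dots> = (\<integral>\<^sup>+\<omega>. ennreal (exp (- r * s)) * f (delay_on (insert j J) s \<omega>) \<partial>env_space r)"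
    by (rule nn_integral_env_resample[OF r, symmetric]) measurable
  also have "\<dots> = ennreal (exp (- r * s)) * (\<integral>\<^sup>+\<omega>. f (delay_on (insert j J) s \<omega>) \<partial>env_space r)"
    by (rule nn_integral_cmult[OF m3])
  finally have "(\<integral>\<^sup>+\<omega>. f \<omega> * indicator {\<omega>. \<forall>y\<in>insert j J. s \<le> fst (shd (\<omega> y))} \<omega> \<partial>env_space r) =
     ennreal (exp (- r * s * card J)) * (ennreal (exp (- r * s)) * (\<integral>\<^sup>+\<omega>. f (delay_on (insert j J) s \<omega>) \<partial>env_space r))" .
  moreover have "exp (- r * s * card (insert j J)) = exp (- r * s * card J) * exp (- r * s)"
    using insert.hyps by (simp add: exp_add[symmetric]) (simp add: algebra_simps)
  ultimately show ?case
    by (simp only: ennreal_mult' exp_ge_zero mult.assoc)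
qed
lemma borel_measurable_env_upd:
  assumes [measurable]: "f \<in> borel_measurable (env_space r)"
  shows "(\<lambda>(w, \<omega>). f (fun_upd \<omega> x w)) \<in> borel_measurable (stream_space (mark_law r) \<Otimes>\<^sub>M env_space r)"
    (is ?P)
    and "(\<lambda>(\<omega>, w). f (fun_upd \<omega> x w)) \<in> borel_measurable (env_space r \<Otimes>\<^sub>M stream_space (mark_law r))"
    (is ?Q)
proof -
  have [measurable]: "(\<lambda>(w, \<omega>). fun_upd \<omega> x w)
      \<in> measurable (stream_space (mark_law r) \<Otimes>\<^sub>M env_space r) (env_space r)"
    by (rule measurable_env_space) (auto simp: case_prod_beta)
  have [measurable]: "(\<lambda>(\<omega>, w). fun_upd \<omega> x w)
      \<in> measurable (env_space r \<Otimes>\<^sub>M stream_space (mark_law r)) (env_space r)"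
    by (rule measurable_env_space) (auto simp: case_prod_beta)
  show ?P ?Q
    by (simp_all add: case_prod_beta) measurable
qed

text \<open>The index \<open>x\<close> of the first mark competes with all other indices, so the rate of the first
  time is \<open>r * card I\<close>. Ties are counted once for each of their indices; only the resulting
  upper bound is needed.\<close>
lemma nn_integral_first_mark:
  assumes r: "0 < r" and I: "finite I" "x \<in> I" and f [measurable]: "f \<in> borel_measurable (env_space r)"
  shows "(\<integral>\<^sup>+\<omega>. f \<omega> * indicator {\<omega>. (\<forall>y\<in>I - {x}. fst (shd (\<omega> x)) \<le> fst (shd (\<omega> y))) \<and>
        fst (shd (\<omega> x)) \<in> {0..t}} \<omega> \<partial>env_space r) =
    (\<integral>\<^sup>+s. ennreal (r * exp (- r * card I * s)) * indicator {0..t} s *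
       (\<integral>\<^sup>+a. (\<integral>\<^sup>+\<omega>. f (first_mark I s x a \<omega>) \<partial>env_space r) \<partial>measure_pmf (bernoulli_pmf (1/2))) \<partial>lborel)"
proof -
  let ?S = "stream_space (mark_law r)"
  let ?J = "I - {x}" and ?B = "measure_pmf (bernoulli_pmf (1/2))"
  let ?E = "density lborel (exponential_density r)"
  interpret S: prob_space ?S by (rule prob_space_stream_mark_law[OF r])
  interpret P: prob_space "env_space r" by (rule prob_space_env_space[OF r])
  interpret SP: pair_sigma_finite ?S "env_space r" ..
  interpret PS: pair_sigma_finite "env_space r" ?S ..
  have cJ: "real (card I) = 1 + real (card ?J)"
    using I by (metis card.remove of_nat_Suc)
  let ?A = "{\<omega>. (\<forall>y\<in>?J. fst (shd (\<omega> x)) \<le> fst (shd (\<omega> y))) \<and> fst (shd (\<omega> x)) \<in> {0..t}}"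
  have "{\<omega> \<in> space (env_space r). (\<forall>y\<in>?J. fst (shd (\<omega> x)) \<le> fst (shd (\<omega> y))) \<and> fst (shd (\<omega> x)) \<in> {0..t}} \<in> sets (env_space r)"
  proof -
    have "(\<lambda>\<omega>. fst (shd (\<omega> y))) \<in> borel_measurable (env_space r)" for y
      by (rule measurable_fst_shd) measurable
    then show ?thesis
      unfolding atLeastAtMost_iff using I
      by (intro sets.sets_Collect_conj sets.sets_Collect_finite_All borel_measurable_le) auto
  qed
  then have A [measurable]: "?A \<in> sets (env_space r)" by simp
  have fA: "(\<lambda>\<omega>. f \<omega> * indicator ?A \<omega>) \<in> borel_measurable (env_space r)"
    by measurable
  have D: "(\<lambda>(w, \<omega>). fun_upd (delay_on ?J (fst (shd w)) \<omega>) x w) \<in> measurable (?S \<Otimes>\<^sub>M env_space r) (env_space r)"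
  proof (rule measurable_env_space)
    fix y
    show "(\<lambda>v. (case v of (w, \<omega>) \<Rightarrow> fun_upd (delay_on ?J (fst (shd w)) \<omega>) x w) y) \<in> measurable (?S \<Otimes>\<^sub>M env_space r) ?S"
      by (cases "y = x"; cases "y \<in> ?J") (simp_all add: delay_on_def case_prod_beta)
  qed
  \<comment> \<open>Once the stream at \<open>x\<close> is fixed, its first time is a constant, and
    the lemma on several delayed streams applies to all the others with this deterministic
    time.\<close>
  define G where "G w = (\<integral>\<^sup>+\<omega>. f (fun_upd (delay_on ?J (fst (shd w)) \<omega>) x w) \<partial>env_space r)" for w
  have G [measurable]: "G \<in> borel_measurable ?S"
    unfolding G_def using measurable_compose[OF D f]
    by (intro P.borel_measurable_nn_integral) (simp add: case_prod_beta)
  define H where "H s a = (\<integral>\<^sup>+\<omega>. f (first_mark I s x a \<omega>) \<partial>env_space r)" for s a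
  have H [measurable]: "(\<lambda>s. \<integral>\<^sup>+a. H s a \<partial>?B) \<in> borel_measurable borel"
    unfolding H_def by measurable
  have "(\<integral>\<^sup>+\<omega>. f \<omega> * indicator ?A \<omega> \<partial>env_space r) =
     (\<integral>\<^sup>+\<omega>. \<integral>\<^sup>+w. f (fun_upd \<omega> x w) * indicator ?A (fun_upd \<omega> x w) \<partial>?S \<partial>env_space r)"
    by (rule nn_integral_env_resample[OF r fA])
  also have "\<dots> = (\<integral>\<^sup>+w. \<integral>\<^sup>+\<omega>. f (fun_upd \<omega> x w) * indicator ?A (fun_upd \<omega> x w) \<partial>env_space r \<partial>?S)"
    by (rule PS.Fubini'[symmetric], rule borel_measurable_env_upd(2)[OF fA])
  also have "\<dots> = (\<integral>\<^sup>+w. indicator {0..t} (fst (shd w)) * (ennreal (exp (- r * fst (shd w) * card ?J)) * G w) \<partial>?S)"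
  proof (intro nn_integral_cong)
    fix w :: "(real \<times> bool) stream"
    let ?s = "fst (shd w)"
    show "(\<integral>\<^sup>+\<omega>. f (fun_upd \<omega> x w) * indicator ?A (fun_upd \<omega> x w) \<partial>env_space r) =
      indicator {0..t} ?s * (ennreal (exp (- r * ?s * card ?J)) * G w)"
    proof (cases "?s \<in> {0..t}")
      case True
      have m: "(\<lambda>\<omega>. f (fun_upd \<omega> x w)) \<in> borel_measurable (env_space r)"
        by (rule measurable_compose[OF measurable_env_space f]) (auto simp: space_stream_space)
      have "(\<integral>\<^sup>+\<omega>. f (fun_upd \<omega> x w) * indicator ?A (fun_upd \<omega> x w) \<partial>env_space r) =
         (\<integral>\<^sup>+\<omega>. f (fun_upd \<omega> x w) * indicator {\<omega>. \<forall>y\<in>?J. ?s \<le> fst (shd (\<omega> y))} \<omega> \<partial>env_space r)"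
        using True by (intro nn_integral_cong) (auto simp: indicator_def)
      also have "\<dots> = ennreal (exp (- r * ?s * card ?J)) * G w"
        unfolding G_def using True I by (intro nn_integral_delay_many[OF r] m) auto
      finally show ?thesis using True by simp
    next
      case False
      then have "indicator ?A (fun_upd \<omega> x w) = (0 :: ennreal)" for \<omega>
        by (auto simp: indicator_def)
      moreover have "indicator {0..t} ?s = (0 :: ennreal)"
        using False by (rule indicator_simps(2))
      ultimately show ?thesis by simp
    qed
  qed
  also have "\<dots> = (\<integral>\<^sup>+s. \<integral>\<^sup>+a. \<integral>\<^sup>+w. indicator {0..t} s * (ennreal (exp (- r * s * card ?J)) * G ((s, a) ## w)) \<partial>?S \<partial>?B \<partial>?E)"
    by (subst nn_integral_mark_stream[OF r]) simp_all
  also have "\<dots> = (\<integral>\<^sup>+s. \<integral>\<^sup>+a. indicator {0..t} s * (ennreal (exp (- r * s * card ?J)) * H s a) \<partial>?B \<partial>?E)"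
  proof (intro nn_integral_cong)
    fix s :: real and a :: bool
    let ?K = "\<lambda>\<omega>. f (first_mark I s x a \<omega>)"
    have K: "?K \<in> borel_measurable (env_space r)"
      by measurable
    have [measurable]: "(\<lambda>w. G ((s, a) ## w)) \<in> borel_measurable ?S"
      by measurable
    \<comment> \<open>Delaying the other streams and prepending the mark at \<open>x\<close> is
      exactly \<open>first_mark\<close>. The tail of the stream at \<open>x\<close> is fresh, so a
      second resampling puts it back into the environment.\<close>
    have "fun_upd (delay_on ?J s \<omega>) x ((s, a) ## w) = first_mark I s x a (fun_upd \<omega> x w)" for \<omega> w
      using I by (auto simp: first_mark_def delay_on_def)
    then have "(\<integral>\<^sup>+w. G ((s, a) ## w) \<partial>?S) = (\<integral>\<^sup>+w. \<integral>\<^sup>+\<omega>. ?K (fun_upd \<omega> x w) \<partial>env_space r \<partial>?S)"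
      unfolding G_def by simp
    also have "\<dots> = (\<integral>\<^sup>+\<omega>. \<integral>\<^sup>+w. ?K (fun_upd \<omega> x w) \<partial>?S \<partial>env_space r)"
      by (rule PS.Fubini', rule borel_measurable_env_upd(2)[OF K])
    also have "\<dots> = H s a"
      unfolding H_def by (rule nn_integral_env_resample[OF r K, symmetric])
    finally show "(\<integral>\<^sup>+w. indicator {0..t} s * (ennreal (exp (- r * s * card ?J)) * G ((s, a) ## w)) \<partial>?S) =
       indicator {0..t} s * (ennreal (exp (- r * s * card ?J)) * H s a)"
      by (simp add: nn_integral_cmult)
  qed
  also have "\<dots> = (\<integral>\<^sup>+s. indicator {0..t} s * (ennreal (exp (- r * s * card ?J)) * (\<integral>\<^sup>+a. H s a \<partial>?B)) \<partial>?E)"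
    by (simp add: nn_integral_cmult)
  also have "\<dots> = (\<integral>\<^sup>+s. ennreal (exponential_density r s) *
      (indicator {0..t} s * (ennreal (exp (- r * s * card ?J)) * (\<integral>\<^sup>+a. H s a \<partial>?B))) \<partial>lborel)"
    by (rule nn_integral_density) measurable
  also have "\<dots> = (\<integral>\<^sup>+s. ennreal (r * exp (- r * card I * s)) * indicator {0..t} s * (\<integral>\<^sup>+a. H s a \<partial>?B) \<partial>lborel)"
  proof (intro nn_integral_cong)
    fix s :: real
    show "ennreal (exponential_density r s) *
      (indicator {0..t} s * (ennreal (exp (- r * s * card ?J)) * (\<integral>\<^sup>+a. H s a \<partial>?B))) =
      ennreal (r * exp (- r * card I * s)) * indicator {0..t} s * (\<integral>\<^sup>+a. H s a \<partial>?B)"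
    proof (cases "s \<in> {0..t}")
      case True
      \<comment> \<open>The rate of the gap at \<open>x\<close> and the rates of the
        \<open>card ?J\<close> competitors add up to \<open>r * card I\<close>.\<close>
      have "exponential_density r s * exp (- r * s * card ?J) = r * exp (- r * card I * s)"
      proof -
        have "exponential_density r s * exp (- r * s * card ?J) = r * (exp (- s * r) * exp (- r * s * card ?J))"
          using True by (simp add: exponential_density_def)
        also have "exp (- s * r) * exp (- r * s * card ?J) = exp (- r * card I * s)"
          unfolding cJ exp_add[symmetric] by (rule arg_cong[where f = exp]) (simp add: algebra_simps)
        finally show ?thesis .
      qed
      moreover have "ennreal (exponential_density r s) * ennreal (exp (- r * s * card ?J)) =
         ennreal (exponential_density r s * exp (- r * s * card ?J))"
        by (intro ennreal_mult'[symmetric] exponential_density_nonneg r)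
      ultimately show ?thesis using True by (simp only: indicator_simps mult_1 mult_1_right mult.assoc[symmetric])
    qed simp
  qed
  finally show ?thesis unfolding H_def .
qed

section \<open>Growth of expectations along the marks\<close>

lemma AE_mark_pos:
  assumes r: "0 < r"
  shows "AE v in mark_law r. 0 < fst v"
proof -
  interpret E: prob_space "density lborel (exponential_density r)"
    by (rule prob_space_exponential_density[OF r])
  interpret EB: pair_sigma_finite "density lborel (exponential_density r)" "measure_pmf (bernoulli_pmf (1/2))" ..
  have "AE u in lborel. u \<noteq> (0 :: real)" by (rule AE_lborel_singleton)
  then have "AE u in density lborel (exponential_density r). 0 < u"
    by (subst AE_density) (auto simp: exponential_density_def elim!: eventually_mono split: if_splits)
  moreover have "{v \<in> space (borel \<Otimes>\<^sub>M count_space UNIV). 0 < (fst v :: real)} \<in> sets (borel \<Otimes>\<^sub>M (count_space UNIV :: bool measure))"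
    by measurable
  then have "{v. 0 < fst v} \<in> sets (mark_law r)"
    by (simp add: sets_mark_law space_pair_measure)
  ultimately show ?thesis
    unfolding mark_law_def
    by (intro EB.AE_pair_measure) (auto simp: space_pair_measure)
qed

lemma all_nat_split: "(\<forall>k. P k) \<longleftrightarrow> P 0 \<and> (\<forall>k. P (Suc k))"
  by (metis not0_implies_Suc)

text \<open>Let p be the probability that no gap exceeds T. Splitting off the first gap gives p = (1
  - exp(-rT)) p, because the remaining gaps form a stream of the same law; hence p = 0.\<close>

lemma AE_mark_exceeds:
  assumes r: "0 < r" and T: "0 \<le> T"
  shows "AE w in stream_space (mark_law r). \<exists>k. T < fst (w !! k)"
proof -
  let ?S = "stream_space (mark_law r)" and ?E = "density lborel (exponential_density r)"
  let ?B = "measure_pmf (bernoulli_pmf (1/2))"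
  interpret S: prob_space ?S by (rule prob_space_stream_mark_law[OF r])
  let ?A = "{w. \<forall>k. fst (w !! k) \<le> T}"
  have "(\<lambda>w. w !! k) \<in> measurable ?S (borel \<Otimes>\<^sub>M count_space UNIV)" for k
    using measurable_snth[of k "mark_law r"] unfolding measurable_cong_sets[OF refl sets_mark_law] .
  from measurable_compose[OF this measurable_fst]
  have "(\<lambda>w. fst (w !! k)) \<in> borel_measurable ?S" for k .
  then have "{w \<in> space ?S. \<forall>k. fst (w !! k) \<le> T} \<in> sets ?S"
    by (intro sets.sets_Collect_countable_All borel_measurable_le) auto
  then have A [measurable]: "?A \<in> sets ?S" by (simp add: space_stream_space)
  have "emeasure ?S ?A = (\<integral>\<^sup>+w. indicator ?A w \<partial>?S)" by simp
  also have "\<dots> = (\<integral>\<^sup>+s. \<integral>\<^sup>+a. \<integral>\<^sup>+w. indicator ?A ((s, a) ## w) \<partial>?S \<partial>?B \<partial>?E)"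
    by (rule nn_integral_mark_stream[OF r]) measurable
  also have "\<dots> = (\<integral>\<^sup>+s. indicator {..T} s * emeasure ?S ?A \<partial>?E)"
  proof (intro nn_integral_cong)
    fix s :: real
    have eq: "indicator ?A ((s, a) ## w) = indicator {..T} s * (indicator ?A w :: ennreal)" for a w
    proof -
      have "(\<forall>k. fst (((s, a) ## w) !! k) \<le> T) \<longleftrightarrow> s \<le> T \<and> (\<forall>k. fst (w !! k) \<le> T)"
        by (subst all_nat_split) simp
      then show ?thesis by (simp add: indicator_def)
    qed
    have "(\<integral>\<^sup>+w. indicator ?A ((s, a) ## w) \<partial>?S) = indicator {..T} s * emeasure ?S ?A" for a
      unfolding eq by (simp add: nn_integral_cmult)
    then show "(\<integral>\<^sup>+a. \<integral>\<^sup>+w. indicator ?A ((s, a) ## w) \<partial>?S \<partial>?B) = indicator {..T} s * emeasure ?S ?A"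
      by (simp add: measure_pmf.emeasure_space_1 del: nn_integral_bernoulli_pmf)
  qed
  also have "\<dots> = ennreal (1 - exp (- r * T)) * emeasure ?S ?A"
    using T r by (simp add: nn_integral_multc emeasure_erlang_density erlang_CDF_0)
  finally have "ennreal (S.prob ?A) = ennreal ((1 - exp (- r * T)) * S.prob ?A)"
    using r T by (simp add: S.emeasure_eq_measure ennreal_mult'[symmetric])
  then have "S.prob ?A = (1 - exp (- r * T)) * S.prob ?A"
    using r T by (subst (asm) ennreal_inj) auto
  then have "S.prob ?A = 0" by (simp add: algebra_simps)
  then have "AE w in ?S. w \<notin> ?A"
    using S.prob_eq_0[OF A] by simp
  then show ?thesis by (auto elim!: eventually_mono simp: not_le)
qed

text \<open>One gap longer than \<open>t\<close> suffices for local finiteness: from that index on,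
  every mark time exceeds \<open>t\<close>, the earlier gaps being positive.\<close>

lemma AE_regular_marks:
  assumes r: "0 < r"
  shows "AE \<omega> in env_space r. regular_marks \<omega>"
proof -
  have comp: "AE \<omega> in env_space r. P (\<omega> x)" if "AE w in stream_space (mark_law r). P w" for P x
    unfolding env_space_def
    by (rule AE_PiM_component[where M = "\<lambda>_. stream_space (mark_law r)"])
       (auto intro: prob_space_stream_mark_law r that)
  have "Measurable.pred (mark_law r) (\<lambda>v. 0 < fst v)"
    by measurable
  from prob_space.AE_stream_all[OF prob_space_mark_law[OF r] this AE_mark_pos[OF r]]
  have "AE w in stream_space (mark_law r). \<forall>k. 0 < fst (w !! k)"
    by (rule eventually_mono) (auto simp: stream_all_def snth_sset)
  then have pos: "AE \<omega> in env_space r. \<forall>x k. 0 < fst (\<omega> x !! k)"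
    by (subst AE_all_countable) (intro allI comp)
  \<comment> \<open>Integer thresholds keep the number of exceptional null sets countable.\<close>
  have "AE w in stream_space (mark_law r). \<forall>j. \<exists>k. real j < fst (w !! k)"
    by (subst AE_all_countable) (intro allI AE_mark_exceeds[OF r] of_nat_0_le_iff)
  then have "AE \<omega> in env_space r. \<forall>x j. \<exists>k. real j < fst (\<omega> x !! k)"
    by (subst AE_all_countable) (intro allI comp)
  with pos show ?thesis
  proof eventually_elim
    case (elim \<omega>)
    have "finite {k. mark_time \<omega> x k \<le> t}" for x t
    proof -
      obtain j where j: "t < real j" using reals_Archimedean2 by blast
      obtain k where k: "real j < fst (\<omega> x !! k)" using elim(2) by blast
      have "i < k" if "mark_time \<omega> x i \<le> t" for i
      proof (rule ccontr)
        assume "\<not> i < k"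
        then have "fst (\<omega> x !! k) \<le> mark_time \<omega> x i"
          unfolding mark_time_def
          using elim(1) by (intro member_le_sum) (auto intro: less_imp_le)
        with that j k show False by linarith
      qed
      then have "{k. mark_time \<omega> x k \<le> t} \<subseteq> {..<k}" by auto
      then show ?thesis by (rule finite_subset) simp
    qed
    with elim show ?case by (simp add: regular_marks_def)
  qed
qed

section \<open>From a one-mark estimate to exponential growth\<close>

lemma ennreal_average:
  assumes "0 \<le> a" "0 \<le> b"
  shows "ennreal a * ennreal (1 / 2) + ennreal b * ennreal (1 / 2) = ennreal ((a + b) / 2)"
proof -
  have "ennreal ((a + b) / 2) = ennreal (a * (1 / 2) + b * (1 / 2))"
    by (simp add: add_divide_distrib)
  also have "\<dots> = ennreal (a * (1 / 2)) + ennreal (b * (1 / 2))"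
    using assms by (intro ennreal_plus) auto
  also have "\<dots> = ennreal a * ennreal (1 / 2) + ennreal b * ennreal (1 / 2)"
    using assms by (simp only: ennreal_mult'')
  finally show ?thesis ..
qed

text \<open>Hypothesis \<open>gen\<close> says that the generator, the sum over pairs of the coin
  average minus \<open>V\<close>, is at most \<open>c * V\<close>. The claimed bound is then a
  supersolution of the equation obtained by conditioning on the first mark, with equality when
  \<open>gen\<close> is an equality. Truncation to words of length at most \<open>k\<close> gives
  the induction a start, and the bound is uniform in \<open>k\<close>.\<close>

lemma nn_integral_mark_word_truncated:
  fixes V :: "'s \<Rightarrow> real" and step :: "int \<Rightarrow> bool \<Rightarrow> 's \<Rightarrow> 's" and N :: nat and c :: real
  defines "I \<equiv> {- int N - 1 .. int N}"
  assumes r: "0 < r" and c: "0 \<le> c" and V: "\<And>st. 0 \<le> V st"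
    and inv: "\<And>st x a. Inv st \<Longrightarrow> x \<in> I \<Longrightarrow> Inv (step x a st)"
    and gen: "\<And>st. Inv st \<Longrightarrow> (\<Sum>x\<in>I. (V (step x True st) + V (step x False st)) / 2) \<le> (card I + c) * V st"
    and "0 \<le> t" "Inv st"
  shows "(\<integral>\<^sup>+\<omega>. ennreal (V (fold (\<lambda>(x, a). step x a) (mark_word N \<omega> t) st)) *
      indicator {L. length L \<le> k} (mark_word N \<omega> t) \<partial>env_space r) \<le> ennreal (exp (r * c * t) * V st)"
  using \<open>0 \<le> t\<close> \<open>Inv st\<close>
proof (induction k arbitrary: t st)
  case 0
  interpret P: prob_space "env_space r" by (rule prob_space_env_space[OF r])
  have "(\<integral>\<^sup>+\<omega>. ennreal (V (fold (\<lambda>(x, a). step x a) (mark_word N \<omega> t) st)) *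
      indicator {L. length L \<le> 0} (mark_word N \<omega> t) \<partial>env_space r) \<le> (\<integral>\<^sup>+\<omega>. ennreal (V st) \<partial>env_space r)"
    by (intro nn_integral_mono) (auto simp: indicator_def)
  also have "\<dots> = ennreal (1 * V st)"
    using P.emeasure_space_1 by simp
  also have "\<dots> \<le> ennreal (exp (r * c * t) * V st)"
    using V[of st] r c 0 by (intro ennreal_leI mult_right_mono) auto
  finally show ?case .
next
  case (Suc k)
  interpret P: prob_space "env_space r" by (rule prob_space_env_space[OF r])
  define F where "F k t st \<omega> = ennreal (V (fold (\<lambda>(x, a). step x a) (mark_word N \<omega> t) st)) *
      indicator {L. length L \<le> k} (mark_word N \<omega> t)" for k t st \<omega>
  have F [measurable]: "F k t st \<in> borel_measurable (env_space r)" for k t st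
    unfolding F_def by (rule measurable_compose[OF measurable_mark_word]) simp
  have I: "finite I" "I \<noteq> {}" by (auto simp: I_def)
  let ?B = "measure_pmf (bernoulli_pmf (1/2))" and ?m = "real (card I)"
  let ?Z = "{\<omega>. \<forall>y\<in>I. t \<le> fst (shd (\<omega> y))}"
  let ?E = "\<lambda>x. {\<omega>. (\<forall>y\<in>I - {x}. fst (shd (\<omega> x)) \<le> fst (shd (\<omega> y))) \<and> fst (shd (\<omega> x)) \<in> {0..t}}"
  have m1 [measurable]: "(\<lambda>\<omega>. fst (shd (\<omega> y))) \<in> borel_measurable (env_space r)" for y
    by (rule measurable_fst_shd) measurable
  have "{\<omega> \<in> space (env_space r). \<forall>y\<in>I. t \<le> fst (shd (\<omega> y))} \<in> sets (env_space r)"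
    using I m1 by (intro sets.sets_Collect_finite_All borel_measurable_le) auto
  then have E0 [measurable]: "?Z \<in> sets (env_space r)" by simp
  have "{\<omega> \<in> space (env_space r). (\<forall>y\<in>I - {x}. fst (shd (\<omega> x)) \<le> fst (shd (\<omega> y))) \<and> fst (shd (\<omega> x)) \<in> {0..t}}
      \<in> sets (env_space r)" for x
    unfolding atLeastAtMost_iff using I m1
    by (intro sets.sets_Collect_conj sets.sets_Collect_finite_All borel_measurable_le) auto
  then have Ex [measurable]: "?E x \<in> sets (env_space r)" for x by simp
  \<comment> \<open>Either no index has a mark up to \<open>t\<close>, or some index attains the
    minimal first time and this time is at most \<open>t\<close>. For an upper bound these events
    need only cover; their overlaps are harmless.\<close>
  have "AE \<omega> in env_space r. F (Suc k) t st \<omega> \<le>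
      ennreal (V st) * indicator ?Z \<omega> + (\<Sum>x\<in>I. F (Suc k) t st \<omega> * indicator (?E x) \<omega>)"
    using AE_regular_marks[OF r]
  proof eventually_elim
    case (elim \<omega>)
    show ?case
    proof (cases "\<forall>y\<in>I. t < fst (shd (\<omega> y))")
      case True
      then have "mark_word N \<omega> t = []"
        using mark_word_Nil[OF elim] by (simp add: I_def)
      then have "F (Suc k) t st \<omega> = ennreal (V st)" by (simp add: F_def)
      moreover have "\<omega> \<in> ?Z" using True by (auto intro: less_imp_le)
      ultimately show ?thesis by simp
    next
      case False
      then obtain y where y: "y \<in> I" "fst (shd (\<omega> y)) \<le> t" by (auto simp: not_less)
      obtain x where x: "x \<in> I" "\<And>y. y \<in> I \<Longrightarrow> fst (shd (\<omega> x)) \<le> fst (shd (\<omega> y))"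
        using ex_min_if_finite[of "(\<lambda>y. fst (shd (\<omega> y))) ` I"] I
        by (metis (no_types, lifting) arg_min_if_finite(1) arg_min_least)
      have "0 \<le> fst (shd (\<omega> x))"
        using elim unfolding regular_marks_def by (metis less_imp_le snth.simps(1))
      then have "\<omega> \<in> ?E x" using x y by fastforce
      then have "F (Suc k) t st \<omega> = F (Suc k) t st \<omega> * indicator (?E x) \<omega>" by simp
      also have "\<dots> \<le> (\<Sum>x\<in>I. F (Suc k) t st \<omega> * indicator (?E x) \<omega>)"
        using I x by (intro member_le_sum) auto
      finally show ?thesis by (simp add: add_increasing)
    qed
  qed
  then have "(\<integral>\<^sup>+\<omega>. F (Suc k) t st \<omega> \<partial>env_space r) \<le>
      (\<integral>\<^sup>+\<omega>. ennreal (V st) * indicator ?Z \<omega> + (\<Sum>x\<in>I. F (Suc k) t st \<omega> * indicator (?E x) \<omega>) \<partial>env_space r)"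
    by (rule nn_integral_mono_AE)
  also have "\<dots> = (\<integral>\<^sup>+\<omega>. ennreal (V st) * indicator ?Z \<omega> \<partial>env_space r) +
      (\<Sum>x\<in>I. \<integral>\<^sup>+\<omega>. F (Suc k) t st \<omega> * indicator (?E x) \<omega> \<partial>env_space r)"
  proof -
    have "(\<lambda>\<omega>. F (Suc k) t st \<omega> * indicator (?E x) \<omega>) \<in> borel_measurable (env_space r)" for x
      by (intro borel_measurable_times_ennreal F borel_measurable_indicator Ex)
    then show ?thesis
      by (subst nn_integral_add) (simp_all add: nn_integral_sum borel_measurable_sum)
  qed
  also have "(\<integral>\<^sup>+\<omega>. ennreal (V st) * indicator ?Z \<omega> \<partial>env_space r) = ennreal (exp (- r * t * ?m) * V st)"
    using nn_integral_delay_many[OF r Suc.prems(1) I(1), of "\<lambda>_. ennreal (V st)"] V P.emeasure_space_1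
    by (simp add: ennreal_mult')
  also have "(\<Sum>x\<in>I. \<integral>\<^sup>+\<omega>. F (Suc k) t st \<omega> * indicator (?E x) \<omega> \<partial>env_space r) \<le>
     (\<Sum>x\<in>I. \<integral>\<^sup>+s. ennreal (r * exp (- r * ?m * s) * exp (r * c * (t - s)) * ((V (step x True st) + V (step x False st)) / 2)) * indicator {0..t} s \<partial>lborel)"
  proof (intro sum_mono)
    fix x assume x: "x \<in> I"
    have le: "(\<integral>\<^sup>+\<omega>. F (Suc k) t st (first_mark I s x a \<omega>) \<partial>env_space r) \<le> ennreal (exp (r * c * (t - s)) * V (step x a st))"
      if s: "s \<in> {0..t}" for s a
    proof -
      \<comment> \<open>Removing the first mark lowers the length bound by one and leaves the time
        \<open>t - s\<close>, as the induction hypothesis requires.\<close>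
      have "AE \<omega> in env_space r. F (Suc k) t st (first_mark I s x a \<omega>) = F k (t - s) (step x a st) \<omega>"
        using AE_regular_marks[OF r]
      proof eventually_elim
        case (elim \<omega>)
        have "mark_word N (first_mark I s x a \<omega>) t = (x, a) # mark_word N \<omega> (t - s)"
          using mark_word_first_mark[OF elim, of s t x N] s x by (simp add: I_def)
        then show ?case by (simp add: F_def indicator_def)
      qed
      then have "(\<integral>\<^sup>+\<omega>. F (Suc k) t st (first_mark I s x a \<omega>) \<partial>env_space r) = (\<integral>\<^sup>+\<omega>. F k (t - s) (step x a st) \<omega> \<partial>env_space r)"
        by (rule nn_integral_cong_AE)
      also have "\<dots> \<le> ennreal (exp (r * c * (t - s)) * V (step x a st))"
        unfolding F_def using s x Suc.prems inv by (intro Suc.IH) auto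
      finally show ?thesis .
    qed
    have "(\<integral>\<^sup>+\<omega>. F (Suc k) t st \<omega> * indicator (?E x) \<omega> \<partial>env_space r) =
      (\<integral>\<^sup>+s. ennreal (r * exp (- r * ?m * s)) * indicator {0..t} s *
       (\<integral>\<^sup>+a. (\<integral>\<^sup>+\<omega>. F (Suc k) t st (first_mark I s x a \<omega>) \<partial>env_space r) \<partial>?B) \<partial>lborel)"
      by (rule nn_integral_first_mark[OF r I(1) x F])
    also have "\<dots> \<le> (\<integral>\<^sup>+s. ennreal (r * exp (- r * ?m * s) * exp (r * c * (t - s)) * ((V (step x True st) + V (step x False st)) / 2)) * indicator {0..t} s \<partial>lborel)"
    proof (intro nn_integral_mono)
      fix s :: real
      show "ennreal (r * exp (- r * ?m * s)) * indicator {0..t} s *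
        (\<integral>\<^sup>+a. (\<integral>\<^sup>+\<omega>. F (Suc k) t st (first_mark I s x a \<omega>) \<partial>env_space r) \<partial>?B) \<le>
        ennreal (r * exp (- r * ?m * s) * exp (r * c * (t - s)) * ((V (step x True st) + V (step x False st)) / 2)) * indicator {0..t} s"
      proof (cases "s \<in> {0..t}")
        case True
        have "(\<integral>\<^sup>+a. (\<integral>\<^sup>+\<omega>. F (Suc k) t st (first_mark I s x a \<omega>) \<partial>env_space r) \<partial>?B) \<le>
           (\<integral>\<^sup>+a. ennreal (exp (r * c * (t - s)) * V (step x a st)) \<partial>?B)"
          by (intro nn_integral_mono le True)
        also have "\<dots> = ennreal (exp (r * c * (t - s)) * V (step x True st)) * ennreal (1 / 2) +
            ennreal (exp (r * c * (t - s)) * V (step x False st)) * ennreal (1 / 2)"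
          by (subst nn_integral_bernoulli_pmf) auto
        also have "\<dots> = ennreal (exp (r * c * (t - s)) * ((V (step x True st) + V (step x False st)) / 2))"
          using V by (subst ennreal_average) (simp_all add: algebra_simps)
        finally have "ennreal (r * exp (- r * ?m * s)) * (\<integral>\<^sup>+a. (\<integral>\<^sup>+\<omega>. F (Suc k) t st (first_mark I s x a \<omega>) \<partial>env_space r) \<partial>?B) \<le>
           ennreal (r * exp (- r * ?m * s)) * ennreal (exp (r * c * (t - s)) * ((V (step x True st) + V (step x False st)) / 2))"
          by (intro mult_left_mono) auto
        then show ?thesis
          using True r by (simp add: ennreal_mult'[symmetric] mult.assoc)
      qed simp
    qed
    finally show "(\<integral>\<^sup>+\<omega>. F (Suc k) t st \<omega> * indicator (?E x) \<omega> \<partial>env_space r) \<le>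
       (\<integral>\<^sup>+s. ennreal (r * exp (- r * ?m * s) * exp (r * c * (t - s)) * ((V (step x True st) + V (step x False st)) / 2)) * indicator {0..t} s \<partial>lborel)" .
  qed
  also have "(\<Sum>x\<in>I. \<integral>\<^sup>+s. ennreal (r * exp (- r * ?m * s) * exp (r * c * (t - s)) * ((V (step x True st) + V (step x False st)) / 2)) * indicator {0..t} s \<partial>lborel) =
     (\<integral>\<^sup>+s. (\<Sum>x\<in>I. ennreal (r * exp (- r * ?m * s) * exp (r * c * (t - s)) * ((V (step x True st) + V (step x False st)) / 2)) * indicator {0..t} s) \<partial>lborel)"
    by (subst nn_integral_sum) auto
  also have "\<dots> \<le> (\<integral>\<^sup>+s. ennreal (exp (r * c * t) * V st * (r * (?m + c) * exp (- (r * (?m + c)) * s))) * indicator {0..t} s \<partial>lborel)"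
  proof (intro nn_integral_mono)
    fix s :: real
    let ?e = "r * exp (- r * ?m * s) * exp (r * c * (t - s))"
    have e: "?e = r * (exp (r * c * t) * exp (- (r * (?m + c)) * s))"
    proof -
      have "exp (- r * ?m * s) * exp (r * c * (t - s)) = exp (r * c * t) * exp (- (r * (?m + c)) * s)"
        unfolding exp_add[symmetric] by (rule arg_cong[where f = exp]) (simp add: algebra_simps)
      then show ?thesis by simp
    qed
    have "(\<Sum>x\<in>I. ennreal (?e * ((V (step x True st) + V (step x False st)) / 2)) * indicator {0..t} s) =
       ennreal (?e * (\<Sum>x\<in>I. (V (step x True st) + V (step x False st)) / 2)) * indicator {0..t} s"
      unfolding sum_distrib_left sum_distrib_right[symmetric] using V r
      by (subst sum_ennreal) auto
    also have "\<dots> \<le> ennreal (?e * ((?m + c) * V st)) * indicator {0..t} s"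
      using gen[OF Suc.prems(2)] r by (intro mult_right_mono ennreal_leI mult_left_mono) auto
    also have "?e * ((?m + c) * V st) = exp (r * c * t) * V st * (r * (?m + c) * exp (- (r * (?m + c)) * s))"
      unfolding e by (simp add: mult_ac)
    finally show "(\<Sum>x\<in>I. ennreal (?e * ((V (step x True st) + V (step x False st)) / 2)) * indicator {0..t} s) \<le>
       ennreal (exp (r * c * t) * V st * (r * (?m + c) * exp (- (r * (?m + c)) * s))) * indicator {0..t} s"
      .
  qed
  \<comment> \<open>The integrand is an exact derivative. Its boundary term at \<open>s = t\<close>
    is minus the contribution of environments without a mark, so the two cancel and only the term at
    \<open>s = 0\<close> remains.\<close>
  also have "\<dots> = ennreal (exp (r * c * t) * V st * (- exp (- (r * (?m + c)) * t)) - exp (r * c * t) * V st * (- exp (- (r * (?m + c)) * 0)))"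
    using Suc.prems(1) r c V
    by (intro nn_integral_FTC_Icc) (auto intro!: derivative_eq_intros)
  finally have "(\<integral>\<^sup>+\<omega>. F (Suc k) t st \<omega> \<partial>env_space r) \<le>
      ennreal (exp (- r * t * ?m) * V st) +
      ennreal (exp (r * c * t) * V st * (- exp (- (r * (?m + c)) * t)) - exp (r * c * t) * V st * (- exp (- (r * (?m + c)) * 0)))"
    by (simp add: add_left_mono)
  also have "\<dots> = ennreal (exp (r * c * t) * V st)"
  proof -
    have e: "exp (r * c * t) * exp (- (r * (?m + c)) * t) = exp (- r * t * ?m)"
      unfolding exp_add[symmetric] by (rule arg_cong[where f = exp]) (simp add: algebra_simps)
    have "exp (r * c * t) * V st * (- exp (- (r * (?m + c)) * t)) - exp (r * c * t) * V st * (- exp (- (r * (?m + c)) * 0)) =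
      V st * (exp (r * c * t) - exp (r * c * t) * exp (- (r * (?m + c)) * t))"
      by (simp add: algebra_simps)
    also have "\<dots> = exp (r * c * t) * V st - exp (- r * t * ?m) * V st"
      unfolding e by (simp add: algebra_simps)
    finally have *: "exp (r * c * t) * V st * (- exp (- (r * (?m + c)) * t)) - exp (r * c * t) * V st * (- exp (- (r * (?m + c)) * 0)) =
      exp (r * c * t) * V st - exp (- r * t * ?m) * V st" .
    have "exp (- r * t * ?m) \<le> exp (r * c * t)"
    proof -
      have "0 \<le> r * t * ?m" "0 \<le> r * c * t" using r c Suc.prems by auto
      then show ?thesis by simp
    qed
    then have "exp (- r * t * ?m) * V st \<le> exp (r * c * t) * V st"
      using V by (intro mult_right_mono) auto
    then show ?thesis unfolding * using V
      by (subst ennreal_plus[symmetric]) auto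
  qed
  finally show ?case unfolding F_def .
qed

text \<open>Every word is a finite list, so the truncated integrands increase to the full one and
  monotone convergence applies.\<close>

lemma nn_integral_mark_word_le:
  fixes V :: "'s \<Rightarrow> real" and step :: "int \<Rightarrow> bool \<Rightarrow> 's \<Rightarrow> 's" and N :: nat and c :: real
  defines "I \<equiv> {- int N - 1 .. int N}"
  assumes "0 < r" "0 \<le> c" "\<And>st. 0 \<le> V st"
    and "\<And>st x a. Inv st \<Longrightarrow> x \<in> I \<Longrightarrow> Inv (step x a st)"
    and "\<And>st. Inv st \<Longrightarrow> (\<Sum>x\<in>I. (V (step x True st) + V (step x False st)) / 2) \<le> (card I + c) * V st"
    and "0 \<le> t" "Inv st"
  shows "(\<integral>\<^sup>+\<omega>. ennreal (V (fold (\<lambda>(x, a). step x a) (mark_word N \<omega> t) st)) \<partial>env_space r)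
    \<le> ennreal (exp (r * c * t) * V st)"
proof -
  let ?F = "\<lambda>k \<omega>. ennreal (V (fold (\<lambda>(x, a). step x a) (mark_word N \<omega> t) st)) *
      indicator {L. length L \<le> k} (mark_word N \<omega> t)"
  have m: "?F k \<in> borel_measurable (env_space r)" for k
    by (rule measurable_compose[OF measurable_mark_word]) simp
  have "ennreal (V (fold (\<lambda>(x, a). step x a) (mark_word N \<omega> t) st)) \<le> (SUP k. ?F k \<omega>)" for \<omega>
    by (rule SUP_upper2[of "length (mark_word N \<omega> t)"]) auto
  then have "(\<integral>\<^sup>+\<omega>. ennreal (V (fold (\<lambda>(x, a). step x a) (mark_word N \<omega> t) st)) \<partial>env_space r) \<le>
     (\<integral>\<^sup>+\<omega>. (SUP k. ?F k \<omega>) \<partial>env_space r)"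
    by (intro nn_integral_mono) auto
  also have "\<dots> = (SUP k. \<integral>\<^sup>+\<omega>. ?F k \<omega> \<partial>env_space r)"
    by (intro nn_integral_monotone_convergence_SUP m)
       (auto simp: incseq_def le_fun_def indicator_def)
  also have "\<dots> \<le> ennreal (exp (r * c * t) * V st)"
    using assms(2-) unfolding I_def by (intro SUP_least nn_integral_mark_word_truncated[where Inv = Inv]) auto
  finally show ?thesis .
qed

section \<open>Weights of stirring configurations\<close>

definition site_swap :: "int \<Rightarrow> int \<Rightarrow> int" where
  "site_swap x y = (if y = x then x + 1 else if y = x + 1 then x else y)"

text \<open>Only the pairs starting at \<open>a\<close> and at \<open>a - 1\<close> move the site
  \<open>a\<close>. At a wall one of them is missing from the range, so the result is the discrete
  Laplacian with the outward jump suppressed.\<close>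

lemma sum_site_swap:
  fixes f :: "int \<Rightarrow> real"
  assumes "inLam N a"
  shows "(\<Sum>x\<in>{- int N..int N - 1}. f (site_swap x a) - f a) =
    (if a < int N then f (a + 1) - f a else 0) + (if - int N < a then f (a - 1) - f a else 0)"
proof -
  have "f (site_swap x a) - f a =
     (if x = a then f (a + 1) - f a else 0) + (if x = a - 1 then f (a - 1) - f a else 0)" for x
    by (auto simp: site_swap_def)
  then show ?thesis
    using assms by (auto simp: sum.distrib inLam_def)
qed

text \<open>Pairs just outside the two sites widen the gap; pairs just inside narrow it. For
  adjacent sites the two inner pairs coincide and the swap preserves the distance, so the narrowing
  term disappears.\<close>

lemma sum_site_swap_dist:
  fixes u :: "int \<Rightarrow> real"
  assumes "inLam N a" "inLam N b" "a < b"
  shows "(\<Sum>x\<in>{- int N..int N - 1}. u \<bar>site_swap x a - site_swap x b\<bar> - u \<bar>a - b\<bar>) =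
    (if - int N < a then u (b - a + 1) - u (b - a) else 0) + (if b < int N then u (b - a + 1) - u (b - a) else 0)
    + (if b = a + 1 then 0 else 2 * (u (b - a - 1) - u (b - a)))"
proof -
  have r: "\<bar>a - b\<bar> = b - a" using assms by simp
  have "u \<bar>site_swap x a - site_swap x b\<bar> - u \<bar>a - b\<bar> =
     (if x = a - 1 then u (b - a + 1) - u (b - a) else 0) + (if x = b then u (b - a + 1) - u (b - a) else 0)
     + (if x = a then (if b = a + 1 then 0 else u (b - a - 1) - u (b - a)) else 0)
     + (if x = b - 1 then (if b = a + 1 then 0 else u (b - a - 1) - u (b - a)) else 0)" for x
  proof -
    consider "x = a - 1" | "x = a" "b = a + 1" | "x = a" "b \<noteq> a + 1" | "x = b - 1" "b \<noteq> a + 1" | "x = b"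
      | "x \<noteq> a - 1" "x \<noteq> a" "x \<noteq> b - 1" "x \<noteq> b" by linarith
    then show ?thesis
    proof cases
      case 1
      then show ?thesis using assms by (auto simp: site_swap_def algebra_simps)
    next
      case 2
      then show ?thesis using assms by (auto simp: site_swap_def)
    next
      case 3
      then have "\<bar>site_swap x a - site_swap x b\<bar> = b - a - 1" using assms by (auto simp: site_swap_def)
      with 3 show ?thesis using assms by (auto simp: r)
    next
      case 4
      then have "\<bar>site_swap x a - site_swap x b\<bar> = b - a - 1" using assms by (auto simp: site_swap_def)
      with 4 show ?thesis using assms by (auto simp: r)
    next
      case 5
      then have "\<bar>site_swap x a - site_swap x b\<bar> = b - a + 1" using assms by (auto simp: site_swap_def)
      with 5 show ?thesis using assms by (auto simp: r)
    next
      case 6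
      then show ?thesis using assms by (auto simp: site_swap_def r)
    qed
  qed
  then show ?thesis
    using assms by (auto simp: sum.distrib inLam_def)
qed

text \<open>This is 2 exp(-\<theta>N) cosh(\<theta>a), an eigenfunction of the discrete Laplacian
  away from the walls. The normalisation makes each exponential at most one on the box and of order
  one at its own wall.\<close>

definition wall_weight :: "nat \<Rightarrow> real \<Rightarrow> int \<Rightarrow> real" where
  "wall_weight N \<theta> a = exp (- \<theta> * (real N - of_int a)) + exp (- \<theta> * (real N + of_int a))"

lemma wall_weight_bounds:
  assumes "inLam N a" "0 \<le> \<theta>"
  shows "0 \<le> wall_weight N \<theta> a" "wall_weight N \<theta> a \<le> 2"
proof -
  have "0 \<le> \<theta> * (real N - of_int a)" "0 \<le> \<theta> * (real N + of_int a)"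
    using assms by (auto simp: inLam_def)
  then have "exp (- \<theta> * (real N - of_int a)) \<le> 1" "exp (- \<theta> * (real N + of_int a)) \<le> 1"
    by simp_all
  then show "wall_weight N \<theta> a \<le> 2" unfolding wall_weight_def by linarith
qed (simp add: wall_weight_def)

lemma exp_second_difference:
  fixes \<theta> :: real
  assumes "0 < \<theta>" "\<theta> \<le> 1"
  shows "0 \<le> exp \<theta> + exp (- \<theta>) - 2" "exp \<theta> + exp (- \<theta>) - 2 \<le> 2 * \<theta>\<^sup>2"
proof -
  have "exp (-\<theta>) = inverse (exp \<theta>)" by (simp add: exp_minus)
  moreover have "exp \<theta> + inverse (exp \<theta>) - 2 = (exp \<theta> - 1)\<^sup>2 / exp \<theta>"
    by (simp add: field_simps power2_eq_square)
  ultimately show "0 \<le> exp \<theta> + exp (- \<theta>) - 2" by simp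
  have "exp \<theta> \<le> 1 + \<theta> + \<theta>\<^sup>2"
    using exp_bound assms by simp
  moreover have "exp (- \<theta>) \<le> 1 - \<theta> + \<theta>\<^sup>2"
  proof -
    have "1 \<le> (1 + \<theta>) * (1 - \<theta> + \<theta>\<^sup>2)"
      \<comment> \<open>The product equals 1 + \<theta>^3.\<close>
      using assms by (simp add: algebra_simps power2_eq_square)
    also have "\<dots> \<le> exp \<theta> * (1 - \<theta> + \<theta>\<^sup>2)"
      using assms by (intro mult_right_mono exp_ge_add_one_self) (auto simp: add_nonneg_nonneg)
    finally show ?thesis by (simp add: exp_minus field_simps)
  qed
  ultimately show "exp \<theta> + exp (- \<theta>) - 2 \<le> 2 * \<theta>\<^sup>2" by simp
qed

text \<open>In the interior the eigenvalue e^\<theta> + e^(-\<theta>) - 2 is at most 2\<theta>^2. At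
  a wall only the inward jump is present and the exponential of that wall drops by 1 -
  e^(-\<theta>); the growth of the other exponential gives the correction factor, where 2N - 1 is
  weakened to N.\<close>

lemma sum_site_swap_wall_weight:
  assumes N: "1 \<le> N" and a: "inLam N a" and \<theta>: "0 < \<theta>" "\<theta> \<le> 1"
  shows "(\<Sum>x\<in>{- int N..int N - 1}. wall_weight N \<theta> (site_swap x a) - wall_weight N \<theta> a) \<le>
    4 * \<theta>\<^sup>2 - (1 - exp (- \<theta>)) * (1 - exp (- \<theta> * N)) * of_bool (\<bar>a\<bar> = int N)"
proof (cases "\<bar>a\<bar> = int N")
  case False
  then have "- int N < a" "a < int N" using a by (auto simp: inLam_def)
  then have "(\<Sum>x\<in>{- int N..int N - 1}. wall_weight N \<theta> (site_swap x a) - wall_weight N \<theta> a) =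
     (wall_weight N \<theta> (a + 1) - wall_weight N \<theta> a) + (wall_weight N \<theta> (a - 1) - wall_weight N \<theta> a)"
    using sum_site_swap[OF a, of "wall_weight N \<theta>"] by simp
  also have "\<dots> = (exp \<theta> + exp (- \<theta>) - 2) * wall_weight N \<theta> a"
  proof -
    define P where "P = exp (- \<theta> * (real N - of_int a))"
    define Q where "Q = exp (- \<theta> * (real N + of_int a))"
    have "wall_weight N \<theta> (a + 1) = exp \<theta> * P + exp (- \<theta>) * Q"
      "wall_weight N \<theta> (a - 1) = exp (- \<theta>) * P + exp \<theta> * Q"
      unfolding wall_weight_def P_def Q_def exp_add[symmetric] by (simp_all add: algebra_simps)
    moreover have "wall_weight N \<theta> a = P + Q" by (simp add: wall_weight_def P_def Q_def)
    ultimately show ?thesis by (simp add: algebra_simps)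
  qed
  also have "\<dots> \<le> 2 * \<theta>\<^sup>2 * 2"
    using exp_second_difference[OF \<theta>] wall_weight_bounds[OF a] \<theta> by (intro mult_mono) auto
  finally show ?thesis using False by simp
next
  case True
  have *: "exp (- \<theta>) + exp (- \<theta> * (2 * real N - 1)) - (1 + exp (- \<theta> * (2 * real N))) \<le>
     - ((1 - exp (- \<theta>)) * (1 - exp (- \<theta> * N)))"
  proof -
    have "exp (- \<theta> * (2 * real N)) = exp (- \<theta>) * exp (- \<theta> * (2 * real N - 1))"
      unfolding exp_add[symmetric] by (rule arg_cong[where f = exp]) (simp add: algebra_simps)
    then have "exp (- \<theta>) + exp (- \<theta> * (2 * real N - 1)) - (1 + exp (- \<theta> * (2 * real N))) =
       - ((1 - exp (- \<theta>)) * (1 - exp (- \<theta> * (2 * real N - 1))))"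
      by (simp add: algebra_simps)
    moreover have "(1 - exp (- \<theta>)) * (1 - exp (- \<theta> * N)) \<le> (1 - exp (- \<theta>)) * (1 - exp (- \<theta> * (2 * real N - 1)))"
      using \<theta> N by (intro mult_left_mono) auto
    ultimately show ?thesis by simp
  qed
  have "a = int N \<or> a = - int N" using True by auto
  then have "(\<Sum>x\<in>{- int N..int N - 1}. wall_weight N \<theta> (site_swap x a) - wall_weight N \<theta> a) =
     exp (- \<theta>) + exp (- \<theta> * (2 * real N - 1)) - (1 + exp (- \<theta> * (2 * real N)))"
    unfolding sum_site_swap[OF a] using N by (auto simp: wall_weight_def algebra_simps)
  moreover have "of_bool (\<bar>a\<bar> = int N) = (1 :: real)" using True by simp
  moreover have "0 \<le> 4 * \<theta>\<^sup>2" by simp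
  ultimately show ?thesis using * by (simp only: mult_1_right)
qed

text \<open>Away from contact and from the walls the distance term is an eigenfunction of the
  stirring generator with eigenvalue of order \<theta>^2. At contact the inward jumps are missing,
  which leaves a decrease of order \<theta>.\<close>

definition pair_weight :: "nat \<Rightarrow> real \<Rightarrow> real \<Rightarrow> int \<Rightarrow> int \<Rightarrow> real" where
  "pair_weight N \<theta> \<gamma> a b = exp (- \<theta> * of_int \<bar>a - b\<bar>) + \<gamma> * (wall_weight N \<theta> a + wall_weight N \<theta> b)"

lemma pair_weight_bounds:
  assumes "inLam N a" "inLam N b" "0 \<le> \<theta>" "0 \<le> \<gamma>"
  shows "0 \<le> pair_weight N \<theta> \<gamma> a b" "pair_weight N \<theta> \<gamma> a b \<le> 1 + 4 * \<gamma>"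
proof -
  note w = wall_weight_bounds[OF assms(1,3)] wall_weight_bounds[OF assms(2,3)]
  show "0 \<le> pair_weight N \<theta> \<gamma> a b"
    using w assms by (simp add: pair_weight_def)
  have "\<gamma> * (wall_weight N \<theta> a + wall_weight N \<theta> b) \<le> \<gamma> * 4"
    using w assms by (intro mult_left_mono) auto
  moreover have "exp (- \<theta> * of_int \<bar>a - b\<bar>) \<le> 1" using assms by simp
  ultimately show "pair_weight N \<theta> \<gamma> a b \<le> 1 + 4 * \<gamma>"
    unfolding pair_weight_def by linarith
qed

lemma pair_weight_commute: "pair_weight N \<theta> \<gamma> a b = pair_weight N \<theta> \<gamma> b a"
  by (simp add: pair_weight_def abs_minus_commute add.commute)

text \<open>The negative term compensates the rate at which adjacent particles collide; the wall weights
  absorb the positive drift that the distance term has at the walls, where outward jumps are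
  suppressed.\<close>
lemma sum_site_swap_pair_weight:
  assumes N: "1 \<le> N" and ab: "inLam N a" "inLam N b" "a \<noteq> b" and \<theta>: "0 < \<theta>" "\<theta> \<le> 1"
    and \<gamma>: "0 \<le> \<gamma>" "1 \<le> \<gamma> * (1 - exp (- \<theta> * N))"
  shows "(\<Sum>x\<in>{- int N..int N - 1}. pair_weight N \<theta> \<gamma> (site_swap x a) (site_swap x b) - pair_weight N \<theta> \<gamma> a b)
    \<le> (4 + 8 * \<gamma>) * \<theta>\<^sup>2 - 2 * exp (- 2) * \<theta> * of_bool (\<bar>a - b\<bar> = 1)"
proof -
  let ?X = "{- int N..int N - 1}" and ?E = "1 - exp (- \<theta>)"
  have wlog: "(\<Sum>x\<in>?X. pair_weight N \<theta> \<gamma> (site_swap x a) (site_swap x b) - pair_weight N \<theta> \<gamma> a b)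
    \<le> (4 + 8 * \<gamma>) * \<theta>\<^sup>2 - 2 * exp (- 2) * \<theta> * of_bool (\<bar>a - b\<bar> = 1)"
    if ab: "inLam N a" "inLam N b" "a < b" for a b
  proof -
    define u :: "int \<Rightarrow> real" where "u r = exp (- \<theta> * of_int r)" for r
    define r where "r = b - a"
    define A where "A = (of_bool (\<bar>a\<bar> = int N) :: real)"
    define B where "B = (of_bool (\<bar>b\<bar> = int N) :: real)"
    have E: "0 \<le> ?E" using \<theta> by simp
    have u: "0 \<le> u r" "u r \<le> 1" using ab \<theta> by (simp_all add: u_def r_def)
    have up: "u (r + 1) - u r = - (?E * u r)"
      by (simp add: u_def algebra_simps exp_add[symmetric])
    have down: "u (r - 1) - u r = (exp \<theta> - 1) * u r"
      by (simp add: u_def algebra_simps exp_add[symmetric])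
    have rc: "b = a + 1 \<longleftrightarrow> r = 1" by (auto simp: r_def)
    have EA: "?E * u r * A \<le> ?E * A" "?E * u r * B \<le> ?E * B"
      using mult_left_mono[OF u(2) E] by (simp_all add: A_def B_def)
    have "(\<Sum>x\<in>?X. u \<bar>site_swap x a - site_swap x b\<bar> - u \<bar>a - b\<bar>) \<le>
        4 * \<theta>\<^sup>2 - 2 * exp (- 2) * \<theta> * of_bool (\<bar>a - b\<bar> = 1) + ?E * A + ?E * B"
    proof -
      have "(\<Sum>x\<in>?X. u \<bar>site_swap x a - site_swap x b\<bar> - u \<bar>a - b\<bar>) =
        (if - int N < a then - (?E * u r) else 0) + (if b < int N then - (?E * u r) else 0)
        + (if r = 1 then 0 else 2 * ((exp \<theta> - 1) * u r))"
        unfolding sum_site_swap_dist[OF ab] r_def[symmetric] rc up down ..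
      \<comment> \<open>A missing outward jump is put back at the price of \<open>?E * u r\<close>,
        hence at most \<open>?E\<close>, for each particle at a wall. The wall weights return
        exactly this amount.\<close>
      also have "(if - int N < a then - (?E * u r) else 0) \<le> - (?E * u r) + ?E * u r * A"
        using ab by (auto simp: A_def inLam_def)
      also have "(if b < int N then - (?E * u r) else 0) \<le> - (?E * u r) + ?E * u r * B"
        using ab by (auto simp: B_def inLam_def)
      also have "(- (?E * u r) + ?E * u r * A) + (- (?E * u r) + ?E * u r * B) + (if r = 1 then 0 else 2 * ((exp \<theta> - 1) * u r))
         \<le> 4 * \<theta>\<^sup>2 - 2 * exp (- 2) * \<theta> * of_bool (\<bar>a - b\<bar> = 1) + ?E * A + ?E * B"
      proof (cases "r = 1")
        case True
        \<comment> \<open>At distance one the right side is e^(-2\<theta>) (e^\<theta> - 1). The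
          bounds \<theta> \<le> 1 and e^\<theta> - 1 \<ge> \<theta> produce the constant
          exp(-2).\<close>
        have "exp (- 2) * \<theta> \<le> ?E * u r"
        proof -
          have "\<theta> \<le> exp \<theta> - 1" using exp_ge_add_one_self[of \<theta>] by linarith
          have "exp (- 2) * \<theta> \<le> exp (- 2 * \<theta>) * (exp \<theta> - 1)"
            using \<theta> \<open>\<theta> \<le> exp \<theta> - 1\<close> by (intro mult_mono) auto
          also have "\<dots> = ?E * u r"
            using True by (simp add: u_def algebra_simps exp_add[symmetric])
          finally show ?thesis .
        qed
        moreover have "of_bool (\<bar>a - b\<bar> = 1) = (1 :: real)" using True ab by (simp add: r_def)
        moreover have "0 \<le> 4 * \<theta>\<^sup>2" by simp
        ultimately show ?thesis using EA by (simp only: if_P[OF True])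
      next
        case False
        have "(exp \<theta> + exp (- \<theta>) - 2) * u r \<le> (2 * \<theta>\<^sup>2) * 1"
          using exp_second_difference[OF \<theta>] u by (intro mult_mono) auto
        moreover have "\<bar>a - b\<bar> \<noteq> 1" using False ab by (simp add: r_def)
        ultimately show ?thesis using EA False by (simp add: algebra_simps)
      qed
      finally show ?thesis by simp
    qed
    moreover have "\<gamma> * (\<Sum>x\<in>?X. wall_weight N \<theta> (site_swap x c) - wall_weight N \<theta> c) \<le>
        4 * \<gamma> * \<theta>\<^sup>2 - ?E * of_bool (\<bar>c\<bar> = int N)" if c: "inLam N c" for c
    proof -
      have "\<gamma> * (\<Sum>x\<in>?X. wall_weight N \<theta> (site_swap x c) - wall_weight N \<theta> c) \<le>
        \<gamma> * (4 * \<theta>\<^sup>2 - ?E * (1 - exp (- \<theta> * N)) * of_bool (\<bar>c\<bar> = int N))"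
        using \<gamma> by (intro mult_left_mono sum_site_swap_wall_weight N c \<theta>)
      also have "\<dots> = 4 * \<gamma> * \<theta>\<^sup>2 - ?E * of_bool (\<bar>c\<bar> = int N) * (\<gamma> * (1 - exp (- \<theta> * N)))"
        by (simp add: algebra_simps)
      \<comment> \<open>The lower bound on \<gamma> is used here: it turns the drop at the wall into
        at least one full \<open>?E\<close>.\<close>
      also have "\<dots> \<le> 4 * \<gamma> * \<theta>\<^sup>2 - ?E * of_bool (\<bar>c\<bar> = int N) * 1"
        using E \<gamma> by (intro diff_left_mono mult_left_mono) auto
      finally show ?thesis by simp
    qed
    from this[OF ab(1)] this[OF ab(2)]
    have "\<gamma> * (\<Sum>x\<in>?X. wall_weight N \<theta> (site_swap x a) - wall_weight N \<theta> a) \<le> 4 * \<gamma> * \<theta>\<^sup>2 - ?E * A"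
      "\<gamma> * (\<Sum>x\<in>?X. wall_weight N \<theta> (site_swap x b) - wall_weight N \<theta> b) \<le> 4 * \<gamma> * \<theta>\<^sup>2 - ?E * B"
      by (simp_all add: A_def B_def)
    moreover have "(\<Sum>x\<in>?X. pair_weight N \<theta> \<gamma> (site_swap x a) (site_swap x b) - pair_weight N \<theta> \<gamma> a b) =
       (\<Sum>x\<in>?X. u \<bar>site_swap x a - site_swap x b\<bar> - u \<bar>a - b\<bar>) +
       \<gamma> * (\<Sum>x\<in>?X. wall_weight N \<theta> (site_swap x a) - wall_weight N \<theta> a) +
       \<gamma> * (\<Sum>x\<in>?X. wall_weight N \<theta> (site_swap x b) - wall_weight N \<theta> b)"
      unfolding sum_distrib_left sum.distrib[symmetric] pair_weight_def u_def
      by (intro sum.cong refl) (simp add: algebra_simps)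
    ultimately show ?thesis by (simp add: algebra_simps)
  qed
  show ?thesis
  proof (cases "a < b")
    case True
    then show ?thesis using wlog ab by simp
  next
    case False
    then have "b < a" using ab by simp
    from wlog[OF ab(2,1) this] show ?thesis
      by (simp only: pair_weight_commute[of N \<theta> \<gamma> "site_swap _ a"] pair_weight_commute[of N \<theta> \<gamma> a] abs_minus_commute[of a])
  qed
qed

section \<open>Dynamics of the discrepancy\<close>

text \<open>With ordered pairs a permutation of the labels acts directly on the index set, with no
  orientation to choose.\<close>

definition pairs :: "nat \<Rightarrow> (nat \<times> nat) set" where
  "pairs n = {(i, j). i \<in> {1..n} \<and> j \<in> {1..n} \<and> i \<noteq> j}"

lemma finite_pairs [simp]: "finite (pairs n)"
  by (rule finite_subset[of _ "{1..n} \<times> {1..n}"]) (auto simp: pairs_def)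

lemma card_pairs_le: "card (pairs n) \<le> n\<^sup>2"
proof -
  have "card (pairs n) \<le> card ({1..n} \<times> {1..n})"
    by (rule card_mono) (auto simp: pairs_def)
  then show ?thesis by (simp add: power2_eq_square)
qed

text \<open>The summand 1 gives a lower bound that lets the weight be dropped at the end, and it
  turns the additive error of order \<theta>^2 in the generator into a multiplicative one.\<close>

definition config_weight :: "nat \<Rightarrow> nat \<Rightarrow> real \<Rightarrow> real \<Rightarrow> (nat \<Rightarrow> int) \<Rightarrow> real" where
  "config_weight N n \<theta> \<gamma> p = 1 + (\<Sum>(i, j)\<in>pairs n. pair_weight N \<theta> \<gamma> (p i) (p j))"

definition adjacent_pairs :: "nat \<Rightarrow> (nat \<Rightarrow> int) \<Rightarrow> real" where
  "adjacent_pairs n p = (\<Sum>(i, j)\<in>pairs n. of_bool (\<bar>p i - p j\<bar> = 1))"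

lemma config_weight_bounds:
  assumes "\<forall>i\<in>{1..n}. inLam N (p i)" "0 \<le> \<theta>" "0 \<le> \<gamma>"
  shows "1 \<le> config_weight N n \<theta> \<gamma> p" "config_weight N n \<theta> \<gamma> p \<le> 1 + (real n)\<^sup>2 * (1 + 4 * \<gamma>)"
proof -
  show "1 \<le> config_weight N n \<theta> \<gamma> p"
    unfolding config_weight_def using assms
    by (auto intro!: sum_nonneg pair_weight_bounds simp: pairs_def)
  have "(\<Sum>(i, j)\<in>pairs n. pair_weight N \<theta> \<gamma> (p i) (p j)) \<le> (\<Sum>v\<in>pairs n. 1 + 4 * \<gamma>)"
    using assms by (intro sum_mono) (auto intro!: pair_weight_bounds simp: pairs_def)
  also have "\<dots> \<le> (real n)\<^sup>2 * (1 + 4 * \<gamma>)"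
    using card_pairs_le[of n] assms by (simp add: mult_right_mono flip: of_nat_power)
  finally show "config_weight N n \<theta> \<gamma> p \<le> 1 + (real n)\<^sup>2 * (1 + 4 * \<gamma>)"
    by (simp add: config_weight_def)
qed

lemma sum_site_swap_config_weight:
  assumes N: "1 \<le> N" and p: "\<forall>i\<in>{1..n}. inLam N (p i)" "inj_on p {1..n}" and \<theta>: "0 < \<theta>" "\<theta> \<le> 1"
    and \<gamma>: "0 \<le> \<gamma>" "1 \<le> \<gamma> * (1 - exp (- \<theta> * N))"
  shows "(\<Sum>x\<in>{- int N..int N - 1}. config_weight N n \<theta> \<gamma> (\<lambda>i. site_swap x (p i)) - config_weight N n \<theta> \<gamma> p)
    \<le> (real n)\<^sup>2 * (4 + 8 * \<gamma>) * \<theta>\<^sup>2 - 2 * exp (- 2) * \<theta> * adjacent_pairs n p"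
proof -
  let ?X = "{- int N..int N - 1}"
  have "(\<Sum>x\<in>?X. config_weight N n \<theta> \<gamma> (\<lambda>i. site_swap x (p i)) - config_weight N n \<theta> \<gamma> p) =
     (\<Sum>(i, j)\<in>pairs n. \<Sum>x\<in>?X. pair_weight N \<theta> \<gamma> (site_swap x (p i)) (site_swap x (p j)) - pair_weight N \<theta> \<gamma> (p i) (p j))"
    unfolding config_weight_def case_prod_beta
    by (subst sum.swap) (simp add: sum_subtractf)
  also have "\<dots> \<le> (\<Sum>(i, j)\<in>pairs n. (4 + 8 * \<gamma>) * \<theta>\<^sup>2 - 2 * exp (- 2) * \<theta> * of_bool (\<bar>p i - p j\<bar> = 1))"
  proof (intro sum_mono, clarify)
    fix i j assume "(i, j) \<in> pairs n"
    then have "i \<in> {1..n}" "j \<in> {1..n}" "i \<noteq> j" by (auto simp: pairs_def)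
    then have "inLam N (p i)" "inLam N (p j)" "p i \<noteq> p j" using p by (auto dest: inj_onD)
    then show "(\<Sum>x\<in>?X. pair_weight N \<theta> \<gamma> (site_swap x (p i)) (site_swap x (p j)) - pair_weight N \<theta> \<gamma> (p i) (p j))
      \<le> (4 + 8 * \<gamma>) * \<theta>\<^sup>2 - 2 * exp (- 2) * \<theta> * of_bool (\<bar>p i - p j\<bar> = 1)"
      by (intro sum_site_swap_pair_weight N \<theta> \<gamma>)
  qed
  also have "\<dots> = real (card (pairs n)) * ((4 + 8 * \<gamma>) * \<theta>\<^sup>2) - 2 * exp (- 2) * \<theta> * adjacent_pairs n p"
    by (simp add: case_prod_beta sum_subtractf adjacent_pairs_def sum_distrib_left)
  also have "\<dots> \<le> (real n)\<^sup>2 * ((4 + 8 * \<gamma>) * \<theta>\<^sup>2) - 2 * exp (- 2) * \<theta> * adjacent_pairs n p"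
    using card_pairs_le[of n] \<gamma> by (intro diff_right_mono mult_right_mono) (auto simp flip: of_nat_power)
  finally show ?thesis by (simp add: mult.assoc)
qed

text \<open>On the configuration the swap acts as the transposition of the labels \<open>i\<close>
  and \<open>j\<close>, so it only reindexes the sum over ordered pairs.\<close>

lemma config_weight_exchange:
  assumes "i \<in> {1..n}" "j \<in> {1..n}" "inj_on p {1..n}" "p i = x" "p j = x + 1"
  shows "config_weight N n \<theta> \<gamma> (\<lambda>k. site_swap x (p k)) = config_weight N n \<theta> \<gamma> p"
proof -
  let ?t = "Transposition.transpose i j"
  have t: "site_swap x (p k) = p (?t k)" if "k \<in> {1..n}" for k
  proof (cases "k = i \<or> k = j")
    case True
    then show ?thesis using assms by (auto simp: site_swap_def)
  next
    case False
    then have "p k \<noteq> x" "p k \<noteq> x + 1"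
      using assms(1,2) that inj_onD[OF assms(3)] by (metis assms(4), metis assms(5))
    with False show ?thesis by (simp add: site_swap_def)
  qed
  have tn: "?t k \<in> {1..n}" if "k \<in> {1..n}" for k
    using assms that by (auto simp: Transposition.transpose_def)
  have tinj: "?t a = ?t b \<longleftrightarrow> a = b" for a b
    by (metis Transposition.transpose_involutory)
  have "(\<Sum>(a, b)\<in>pairs n. pair_weight N \<theta> \<gamma> (site_swap x (p a)) (site_swap x (p b))) =
      (\<Sum>(a, b)\<in>pairs n. pair_weight N \<theta> \<gamma> (p a) (p b))"
    by (rule sum.reindex_bij_witness[of _ "\<lambda>(a, b). (?t a, ?t b)" "\<lambda>(a, b). (?t a, ?t b)"])
       (simp_all add: case_prod_beta pairs_def t tn tinj del: atLeastAtMost_iff One_nat_def)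
  then show ?thesis by (simp add: config_weight_def)
qed

text \<open>Collisions with every label are counted, whatever its priority: an upper bound on those
  that move the discrepancy.\<close>

definition collides :: "nat \<Rightarrow> (nat \<Rightarrow> int) \<Rightarrow> nat \<Rightarrow> int \<Rightarrow> bool" where
  "collides n p l x \<longleftrightarrow> (\<exists>j\<in>{1..n}. j \<noteq> l \<and> {p j, p l} = {x, x + 1})"

text \<open>A collision at \<open>x\<close> is charged to the ordered pair (j, l) whose smaller site
  is \<open>x\<close>; each pair is charged at most once.\<close>

lemma sum_collides_le:
  assumes l: "l \<in> {1..n}" and X: "finite X"
  shows "(\<Sum>x\<in>X. of_bool (collides n p l x)) \<le> adjacent_pairs n p"
proof -
  have "(of_bool (collides n p l x) :: real) \<le> (\<Sum>(i, j)\<in>pairs n. if x = min (p i) (p j) then of_bool (\<bar>p i - p j\<bar> = 1) else 0)" for x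
  proof (cases "collides n p l x")
    case True
    then obtain j where j: "j \<in> {1..n}" "j \<noteq> l" "{p j, p l} = {x, x + 1}" by (auto simp: collides_def)
    then have "(j, l) \<in> pairs n" using l by (simp add: pairs_def)
    moreover have "x = min (p j) (p l)" "\<bar>p j - p l\<bar> = 1" using j(3) by (auto simp: doubleton_eq_iff)
    ultimately show ?thesis
      using True member_le_sum[of "(j, l)" "pairs n" "\<lambda>(i, j). if x = min (p i) (p j) then of_bool (\<bar>p i - p j\<bar> = 1) else (0::real)"]
      by auto
  qed (auto intro!: sum_nonneg)
  then have "(\<Sum>x\<in>X. of_bool (collides n p l x)) \<le>
     (\<Sum>x\<in>X. \<Sum>(i, j)\<in>pairs n. if x = min (p i) (p j) then of_bool (\<bar>p i - p j\<bar> = 1) else (0::real))"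
    by (intro sum_mono)
  also have "\<dots> = (\<Sum>(i, j)\<in>pairs n. \<Sum>x\<in>X. if x = min (p i) (p j) then of_bool (\<bar>p i - p j\<bar> = 1) else (0::real))"
    unfolding case_prod_beta by (rule sum.swap)
  also have "\<dots> \<le> adjacent_pairs n p"
    unfolding adjacent_pairs_def using X by (intro sum_mono) (auto simp: sum.delta')
  finally show ?thesis .
qed

section \<open>Invariant states and the effect of a single mark\<close>

definition valid_state :: "nat \<Rightarrow> nat \<Rightarrow> (nat \<Rightarrow> int) \<times> (nat \<Rightarrow> int) \<Rightarrow> bool" where
  "valid_state N n st \<longleftrightarrow> inj_on (fst st) {1..n} \<and>
     (\<forall>i\<in>{1..n}. inLam N (fst st i)) \<and> (\<forall>i\<in>{1..n}. inLam N (snd st i))"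

lemma fst_mark_step:
  "fst (mark_step N n \<sigma> x a (p, q)) = (if a \<and> inLam N x \<and> inLam N (x + 1) then (\<lambda>i. site_swap x (p i)) else p)"
  by (simp add: mark_step_def Let_def site_swap_def)

lemma snd_mark_step:
  "snd (mark_step N n \<sigma> x a (p, q)) =
     (if \<forall>i\<in>{1..n}. inLam N (coupled_new N n \<sigma> x a p q i) then coupled_new N n \<sigma> x a p q else q)"
  by (simp add: mark_step_def Let_def)

lemma site_swap_eq_iff: "site_swap x y = site_swap x z \<longleftrightarrow> y = z"
  by (auto simp: site_swap_def)

lemma valid_state_mark_step:
  assumes "valid_state N n st"
  shows "valid_state N n (mark_step N n \<sigma> x a st)"
proof -
  obtain p q where st: "st = (p, q)" by (rule prod.exhaust)
  have pq: "inj_on p {1..n}" "\<forall>i\<in>{1..n}. inLam N (p i)" "\<forall>i\<in>{1..n}. inLam N (q i)"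
    using assms unfolding valid_state_def st fst_conv snd_conv by blast+
  let ?p = "fst (mark_step N n \<sigma> x a (p, q))" and ?q = "snd (mark_step N n \<sigma> x a (p, q))"
  have "inj_on ?p {1..n} \<and> (\<forall>i\<in>{1..n}. inLam N (?p i))"
  proof (cases "a \<and> inLam N x \<and> inLam N (x + 1)")
    case True
    then have "?p = (\<lambda>i. site_swap x (p i))" unfolding fst_mark_step by (rule if_P)
    moreover have "inj_on (\<lambda>i. site_swap x (p i)) {1..n}"
      using pq(1) unfolding inj_on_def site_swap_eq_iff .
    moreover have "inLam N (site_swap x y)" if "inLam N y" for y
      using True that by (simp add: site_swap_def)
    ultimately show ?thesis using pq(2) by (simp only:) blast
  next
    case False
    then have "?p = p" unfolding fst_mark_step by (rule if_not_P)
    then show ?thesis using pq by (simp only:)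
  qed
  moreover have "\<forall>i\<in>{1..n}. inLam N (?q i)"
    unfolding snd_mark_step
    by (rule if_split[where P = "\<lambda>f. \<forall>i\<in>{1..n}. inLam N (f i)", THEN iffD2]) (use pq(3) in blast)
  ultimately show ?thesis unfolding valid_state_def st by blast
qed

lemma arg_min_on_doubleton: "arg_min_on f {i, j} \<in> {i, j}" for f :: "'a \<Rightarrow> 'b::linorder"
  by (rule arg_min_if_finite(1)) auto

lemma coupled_new_not_in_pair:
  assumes x: "inLam N x" "inLam N (x + 1)" and l: "l \<notin> {i \<in> {1..n}. p i = x \<or> p i = x + 1}"
  shows "coupled_new N n \<sigma> x a p q l = q l"
proof -
  define occ where "occ = {i \<in> {1..n}. p i = x \<or> p i = x + 1}"
  have l: "l \<notin> occ" unfolding occ_def by (rule l)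
  have one: "the_elem occ \<noteq> l" if c: "card occ = 1"
    using c l by (auto simp: card_1_singleton_iff)
  have two: "arg_min_on \<sigma> occ \<noteq> l" "the_elem (occ - {arg_min_on \<sigma> occ}) \<noteq> l" if c: "card occ = 2"
  proof -
    obtain i j where ij: "occ = {i, j}" "i \<noteq> j" using c by (auto simp: card_2_iff)
    have am: "arg_min_on \<sigma> occ = i \<or> arg_min_on \<sigma> occ = j"
      using arg_min_on_doubleton[of \<sigma> i j] unfolding ij(1) by blast
    have "occ - {i} = {j}" "occ - {j} = {i}" using ij by blast+
    then have "the_elem (occ - {arg_min_on \<sigma> occ}) \<in> {i, j}"
      using am by (elim disjE) (simp_all only: the_elem_eq insertI1 insert_iff simp_thms)
    moreover have "l \<notin> {i, j}" using l ij(1) by blast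
    ultimately show "arg_min_on \<sigma> occ \<noteq> l" "the_elem (occ - {arg_min_on \<sigma> occ}) \<noteq> l"
      using am by blast+
  qed
  consider "card occ = 1" | "card occ = 2" | "card occ \<noteq> 1" "card occ \<noteq> 2" by blast
  then show ?thesis
  proof cases
    case 1
    have "(q(the_elem occ := y)) l = q l" for y using one[OF 1] by simp
    then show ?thesis
      unfolding coupled_new_def Let_def occ_def[symmetric]
      by (simp only: x 1 simp_thms if_True if_False split: if_split)
  next
    case 2
    have "(q(arg_min_on \<sigma> occ := y)) l = q l" "(q(the_elem (occ - {arg_min_on \<sigma> occ}) := y)) l = q l" for y
      using two[OF 2] by simp_all
    moreover have "card occ \<noteq> 1" using 2 by simp
    ultimately show ?thesis
      unfolding coupled_new_def Let_def occ_def[symmetric]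
      by (simp only: x 2 simp_thms if_True if_False split: if_split)
  next
    case 3
    then show ?thesis
      unfolding coupled_new_def Let_def occ_def[symmetric]
      by (simp only: x simp_thms if_True if_False split: if_split)
  qed
qed

lemma coupled_new_single:
  assumes x: "inLam N x" "inLam N (x + 1)" and occ: "{i \<in> {1..n}. p i = x \<or> p i = x + 1} = {l}"
  shows "coupled_new N n \<sigma> x a p q = (if a then q(l := q l + (site_swap x (p l) - p l)) else q)"
proof -
  have "p l = x \<or> p l = x + 1" using occ by blast
  then show ?thesis
    unfolding coupled_new_def Let_def occ using x by (auto simp: site_swap_def)
qed

lemma coupled_new_double:
  assumes x: "inLam N x" "inLam N (x + 1)" and occ: "{k \<in> {1..n}. p k = x \<or> p k = x + 1} = {i, j}"
    and ij: "i \<noteq> j" and m: "arg_min_on \<sigma> {i, j} = i"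
  shows "coupled_new N n \<sigma> x a p q = (if a then q(i := q i + (p j - p i)) else q(j := q j - (p j - p i)))"
proof -
  have "{i, j} - {i} = {j}" "card {i, j} = 2" using ij by auto
  then show ?thesis
    unfolding coupled_new_def Let_def occ m using x by simp
qed

text \<open>Seen from a single label, the priority rules reduce to three cases. The label is
  untouched; or it copies its own stirring jump on active marks, being alone or having priority; or
  it yields, and makes the same jump on passive marks instead.\<close>

lemma coupled_new_interior:
  assumes x: "inLam N x" "inLam N (x + 1)" and p: "inj_on p {1..n}" and l: "l \<in> {1..n}"
  shows "(\<forall>a. coupled_new N n \<sigma> x a p q l = q l) \<and> site_swap x (p l) = p l
    \<or> coupled_new N n \<sigma> x True p q = q(l := q l + (site_swap x (p l) - p l)) \<and>
       coupled_new N n \<sigma> x False p q l = q l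
    \<or> collides n p l x \<and> coupled_new N n \<sigma> x True p q l = q l \<and>
       coupled_new N n \<sigma> x False p q = q(l := q l + (site_swap x (p l) - p l))"
proof -
  let ?occ = "{i \<in> {1..n}. p i = x \<or> p i = x + 1}"
  consider (away) "l \<notin> ?occ" | (single) "?occ = {l}" | (double) "l \<in> ?occ" "?occ \<noteq> {l}" by blast
  then show ?thesis
  proof cases
    case away
    then have "p l \<noteq> x" "p l \<noteq> x + 1" using l by blast+
    then have "site_swap x (p l) = p l" by (simp add: site_swap_def)
    with coupled_new_not_in_pair[OF x away] show ?thesis by blast
  next
    case single
    have "coupled_new N n \<sigma> x True p q = q(l := q l + (site_swap x (p l) - p l))"
      "coupled_new N n \<sigma> x False p q l = q l"
      unfolding coupled_new_single[OF x single] by simp_all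
    then show ?thesis by blast
  next
    case double
    then obtain j where j: "j \<in> ?occ" "j \<noteq> l" by blast
    have pjl: "p l \<noteq> p j" using j l inj_onD[OF p, of l j] by blast
    have "p l = x \<or> p l = x + 1" "p j = x \<or> p j = x + 1" using j double(1) by blast+
    with pjl have s: "p l = x \<and> p j = x + 1 \<or> p l = x + 1 \<and> p j = x" by metis
    have occ: "?occ = {l, j}"
    proof (intro equalityI subsetI)
      fix k assume k: "k \<in> ?occ"
      then have "p k = x \<or> p k = x + 1" by blast
      then have "p k = p l \<or> p k = p j" using s by metis
      moreover have "k \<in> {1..n}" "j \<in> {1..n}" using k j by blast+
      ultimately show "k \<in> {l, j}" using l inj_onD[OF p] by blast
    qed (use double(1) j in blast)
    have d: "site_swap x (p l) - p l = p j - p l" using s by (auto simp: site_swap_def)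
    have "{p j, p l} = {x, x + 1}" using s by auto
    then have col: "collides n p l x" unfolding collides_def using j by blast
    have "arg_min_on \<sigma> {l, j} = l \<or> arg_min_on \<sigma> {l, j} = j"
      using arg_min_on_doubleton[of \<sigma> l j] by blast
    then show ?thesis
    proof
      assume "arg_min_on \<sigma> {l, j} = l"
      from coupled_new_double[OF x occ j(2)[symmetric] this]
      have "coupled_new N n \<sigma> x True p q = q(l := q l + (p j - p l))"
        "coupled_new N n \<sigma> x False p q l = q l"
        using j(2) by simp_all
      then show ?thesis unfolding d by blast
    next
      assume "arg_min_on \<sigma> {l, j} = j"
      then have m: "arg_min_on \<sigma> {j, l} = j" by (simp only: insert_commute)
      have occ': "?occ = {j, l}" unfolding occ by (rule insert_commute)
      note e = coupled_new_double[OF x occ' j(2) m]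
      have "coupled_new N n \<sigma> x True p q l = q l"
        "coupled_new N n \<sigma> x False p q = q(l := q l + (p j - p l))"
        unfolding e using j(2) by (simp_all add: algebra_simps)
      with col show ?thesis unfolding d by blast
    qed
  qed
qed

definition discrepancy :: "nat \<Rightarrow> (nat \<Rightarrow> int) \<times> (nat \<Rightarrow> int) \<Rightarrow> int" where
  "discrepancy l st = fst st l - snd st l"

text \<open>A copied jump preserves the discrepancy unless it is suppressed. In that case the
  coupled particle sits at a wall while the stirring target stays in the box, so the distance
  shrinks. For a yielding label the two outcomes give opposite steps \<open>d\<close> and
  \<open>-d\<close>; if the coupled jump is suppressed, the unchanged discrepancy is still no larger
  in modulus than its value shifted by \<open>-d\<close>.\<close>

lemma discrepancy_mark_step_interior:
  assumes x: "inLam N x" "inLam N (x + 1)" and st: "valid_state N n (p, q)" and l: "l \<in> {1..n}"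
  shows "(\<forall>a. \<bar>discrepancy l (mark_step N n \<sigma> x a (p, q))\<bar> \<le> \<bar>p l - q l\<bar>)
   \<or> collides n p l x \<and> (\<exists>d. \<bar>d\<bar> = 1 \<and> discrepancy l (mark_step N n \<sigma> x True (p, q)) = p l - q l + d \<and>
       \<bar>discrepancy l (mark_step N n \<sigma> x False (p, q))\<bar> \<le> \<bar>p l - q l - d\<bar>)"
proof -
  have p: "inj_on p {1..n}" and inL: "inLam N (p l)" "\<forall>i\<in>{1..n}. inLam N (q i)"
    using st l by (auto simp: valid_state_def)
  then have ql: "inLam N (q l)" using l by auto
  have sw: "inLam N (site_swap x (p l))" using x inL by (auto simp: site_swap_def)
  have sw1: "\<bar>site_swap x (p l) - p l\<bar> \<le> 1" by (auto simp: site_swap_def)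
  have out: "(\<forall>i\<in>{1..n}. inLam N ((q(l := y)) i)) \<longleftrightarrow> inLam N y" for y
    using inL l by auto
  have keep: "snd (mark_step N n \<sigma> x a (p, q)) l = q l" if "coupled_new N n \<sigma> x a p q l = q l" for a
    using that by (simp add: snd_mark_step)
  have move: "snd (mark_step N n \<sigma> x a (p, q)) l = (if inLam N y then y else q l)"
    if "coupled_new N n \<sigma> x a p q = q(l := y)" for a y
    unfolding snd_mark_step that out by simp
  have fstT: "fst (mark_step N n \<sigma> x True (p, q)) l = site_swap x (p l)"
    and fstF: "fst (mark_step N n \<sigma> x False (p, q)) l = p l"
    using x by (simp_all add: fst_mark_step)
  consider (away) "\<forall>a. coupled_new N n \<sigma> x a p q l = q l" "site_swap x (p l) = p l"
    | (free) "coupled_new N n \<sigma> x True p q = q(l := q l + (site_swap x (p l) - p l))"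
        "coupled_new N n \<sigma> x False p q l = q l"
    | (yields) "collides n p l x" "coupled_new N n \<sigma> x True p q l = q l"
        "coupled_new N n \<sigma> x False p q = q(l := q l + (site_swap x (p l) - p l))"
    using coupled_new_interior[OF x p l, of \<sigma> q] by blast
  then show ?thesis
  proof cases
    case away
    then have "discrepancy l (mark_step N n \<sigma> x a (p, q)) = p l - q l" for a
      using fstT fstF keep by (cases a) (auto simp: discrepancy_def)
    then show ?thesis by simp
  next
    case free
    have "\<bar>discrepancy l (mark_step N n \<sigma> x True (p, q))\<bar> \<le> \<bar>p l - q l\<bar>"
      using move[OF free(1)] fstT sw sw1 inL(1) ql
      by (auto simp: discrepancy_def inLam_def abs_if split: if_splits)
    moreover have "discrepancy l (mark_step N n \<sigma> x False (p, q)) = p l - q l"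
      using fstF keep[OF free(2)] by (simp add: discrepancy_def)
    ultimately show ?thesis by (metis order_refl)
  next
    case yields
    let ?d = "site_swap x (p l) - p l"
    have "\<bar>?d\<bar> = 1" using yields(1) by (auto simp: collides_def site_swap_def doubleton_eq_iff)
    moreover have "discrepancy l (mark_step N n \<sigma> x True (p, q)) = p l - q l + ?d"
      using fstT keep[OF yields(2)] by (simp add: discrepancy_def)
    moreover have "\<bar>discrepancy l (mark_step N n \<sigma> x False (p, q))\<bar> \<le> \<bar>p l - q l - ?d\<bar>"
      using move[OF yields(3)] fstF sw \<open>\<bar>?d\<bar> = 1\<close> inL(1) ql
      by (auto simp: discrepancy_def inLam_def abs_if split: if_splits)
    ultimately show ?thesis using yields(1) by blast
  qed
qed

text \<open>An outer pair has one site in the box, the wall site \<open>w\<close>. A stirring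
  particle there stays, and its coupled particle can only move outward, hence towards
  \<open>w\<close>, or be stopped by the wall.\<close>

lemma discrepancy_mark_step_wall:
  assumes x: "x = - int N - 1 \<or> x = int N" and st: "valid_state N n (p, q)" and l: "l \<in> {1..n}"
  shows "\<bar>discrepancy l (mark_step N n \<sigma> x a (p, q))\<bar> \<le> \<bar>p l - q l\<bar>"
proof -
  let ?occ = "{i \<in> {1..n}. p i = x \<or> p i = x + 1}"
  have p: "inj_on p {1..n}" and inL: "\<forall>i\<in>{1..n}. inLam N (p i)" "\<forall>i\<in>{1..n}. inLam N (q i)"
    using st l by (auto simp: valid_state_def)
  have pl: "inLam N (p l)" and ql: "inLam N (q l)" using inL l by auto
  define w where "w = (if x = int N then int N else - int N)"
  define e where "e = (if x = int N then 1 else - 1 :: int)"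
  have xN: "\<not> (inLam N x \<and> inLam N (x + 1))" using x by (auto simp: inLam_def)
  have occ: "?occ = {i \<in> {1..n}. p i = w}"
    using x inL(1) by (fastforce simp: w_def inLam_def)
  have single: "?occ = {i}" if "i \<in> ?occ" for i
    using that p unfolding occ by (auto dest: inj_onD)
  have new: "coupled_new N n \<sigma> x a p q = (if a then q(i := q i + e) else q)" if "i \<in> ?occ" for i
    using x unfolding coupled_new_def Let_def single[OF that] e_def by (auto simp: inLam_def)
  have fst: "fst (mark_step N n \<sigma> x a (p, q)) = p"
    using xN by (auto simp: fst_mark_step)
  show ?thesis
  proof (cases "l \<in> ?occ")
    case True
    then have "p l = w" unfolding occ by simp
    then show ?thesis
      using new[OF True] fst pl ql x l
      by (auto simp: discrepancy_def snd_mark_step w_def e_def inLam_def)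
  next
    case False
    have "coupled_new N n \<sigma> x a p q l = q l"
    proof (cases "?occ = {}")
      case True
      then show ?thesis unfolding coupled_new_def Let_def by simp
    next
      case False
      then obtain i where i: "i \<in> ?occ" by blast
      with \<open>l \<notin> ?occ\<close> have "i \<noteq> l" by blast
      then show ?thesis unfolding new[OF i] by simp
    qed
    then show ?thesis using fst by (simp add: discrepancy_def snd_mark_step)
  qed
qed

section \<open>The Lyapunov function\<close>

text \<open>Suppressed moves are controlled only through the modulus of the discrepancy, which calls
  for an even function, increasing in the modulus.\<close>

definition lyapunov :: "nat \<Rightarrow> nat \<Rightarrow> real \<Rightarrow> real \<Rightarrow> real \<Rightarrow> nat \<Rightarrow> (nat \<Rightarrow> int) \<times> (nat \<Rightarrow> int) \<Rightarrow> real" where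
  "lyapunov N n \<theta> \<gamma> \<beta> l st = cosh (\<beta> * of_int (discrepancy l st)) * config_weight N n \<theta> \<gamma> (fst st)"

text \<open>Stated for arbitrary \<open>p\<close>, because the growth bound asks for a function that
  is nonnegative on all states and not only on valid ones.\<close>

lemma config_weight_ge_1:
  assumes "0 \<le> \<gamma>"
  shows "1 \<le> config_weight N n \<theta> \<gamma> p"
proof -
  have "0 \<le> pair_weight N \<theta> \<gamma> a b" for a b
    using assms by (simp add: pair_weight_def wall_weight_def)
  then show ?thesis unfolding config_weight_def by (simp add: sum_nonneg case_prod_beta)
qed

lemma cosh_mult_mono_abs:
  fixes a b :: int
  assumes "\<bar>a\<bar> \<le> \<bar>b\<bar>"
  shows "cosh (\<beta> * of_int a) \<le> cosh (\<beta> * of_int b :: real)"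
proof -
  have "\<bar>\<beta> * of_int a\<bar> \<le> \<bar>\<beta> * of_int b :: real\<bar>"
    unfolding abs_mult using assms by (intro mult_left_mono) (auto simp flip: of_int_abs)
  then have "cosh \<bar>\<beta> * of_int a\<bar> \<le> cosh \<bar>\<beta> * of_int b :: real\<bar>"
    by (subst cosh_real_nonneg_le_iff) auto
  then show ?thesis by simp
qed

lemma lyapunov_nonneg: "0 \<le> \<gamma> \<Longrightarrow> 0 \<le> lyapunov N n \<theta> \<gamma> \<beta> l st"
  unfolding lyapunov_def using config_weight_ge_1[of \<gamma> N n \<theta> "fst st"]
  by (intro mult_nonneg_nonneg cosh_real_nonneg) linarith

lemma cosh_le_lyapunov:
  assumes "0 \<le> \<gamma>"
  shows "cosh (\<beta> * of_int (discrepancy l st)) \<le> lyapunov N n \<theta> \<gamma> \<beta> l st"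
  unfolding lyapunov_def using mult_left_mono[OF config_weight_ge_1[OF assms] cosh_real_nonneg] by simp

lemma cosh_add_plus_cosh_diff: "cosh (a + b) + cosh (a - b) = 2 * cosh a * cosh (b :: real)"
  by (simp add: cosh_add cosh_diff)

text \<open>Without a step of the discrepancy, only the weight changes and the coin averages its old
  and new value. At a step, the weight is the same for both outcomes and the two cosh values average
  to at most cosh \<beta> times the old one; the last term records this excess.\<close>

lemma lyapunov_step_interior:
  assumes x: "inLam N x" "inLam N (x + 1)" and st: "valid_state N n (p, q)" and l: "l \<in> {1..n}" and \<gamma>: "0 \<le> \<gamma>"
  shows "(lyapunov N n \<theta> \<gamma> \<beta> l (mark_step N n \<sigma> x True (p, q)) + lyapunov N n \<theta> \<gamma> \<beta> l (mark_step N n \<sigma> x False (p, q))) / 2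
    \<le> cosh (\<beta> * of_int (p l - q l)) * ((config_weight N n \<theta> \<gamma> (\<lambda>i. site_swap x (p i)) + config_weight N n \<theta> \<gamma> p) / 2
        + (cosh \<beta> - 1) * config_weight N n \<theta> \<gamma> p * of_bool (collides n p l x))"
proof -
  let ?g = "config_weight N n \<theta> \<gamma> p" and ?g' = "config_weight N n \<theta> \<gamma> (\<lambda>i. site_swap x (p i))"
  let ?D = "p l - q l"
  let ?T = "discrepancy l (mark_step N n \<sigma> x True (p, q))" and ?F = "discrepancy l (mark_step N n \<sigma> x False (p, q))"
  have g: "0 \<le> ?g" "0 \<le> ?g'"
    using config_weight_ge_1[OF \<gamma>] by (meson order_trans zero_le_one)+
  have VT: "lyapunov N n \<theta> \<gamma> \<beta> l (mark_step N n \<sigma> x True (p, q)) = cosh (\<beta> * of_int ?T) * ?g'"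
    and VF: "lyapunov N n \<theta> \<gamma> \<beta> l (mark_step N n \<sigma> x False (p, q)) = cosh (\<beta> * of_int ?F) * ?g"
    using x by (simp_all add: lyapunov_def fst_mark_step)
  from discrepancy_mark_step_interior[OF x st l, of \<sigma>] show ?thesis
  proof
    assume "\<forall>a. \<bar>discrepancy l (mark_step N n \<sigma> x a (p, q))\<bar> \<le> \<bar>?D\<bar>"
    then have "cosh (\<beta> * of_int ?T) * ?g' \<le> cosh (\<beta> * of_int ?D) * ?g'"
      "cosh (\<beta> * of_int ?F) * ?g \<le> cosh (\<beta> * of_int ?D) * ?g"
      using g by (auto intro!: mult_right_mono cosh_mult_mono_abs simp del: of_int_diff)
    moreover have "0 \<le> cosh (\<beta> * of_int ?D) * ((cosh \<beta> - 1) * ?g * of_bool (collides n p l x))"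
      using g cosh_real_ge_1[of \<beta>] by (intro mult_nonneg_nonneg) auto
    ultimately show ?thesis
      unfolding VT VF by (simp only: distrib_left add_divide_distrib times_divide_eq_right)
  next
    assume "collides n p l x \<and> (\<exists>d. \<bar>d\<bar> = 1 \<and> ?T = ?D + d \<and> \<bar>?F\<bar> \<le> \<bar>?D - d\<bar>)"
    then obtain d where col: "collides n p l x" and d: "\<bar>d\<bar> = 1" "?T = ?D + d" "\<bar>?F\<bar> \<le> \<bar>?D - d\<bar>" by blast
    obtain j where j: "j \<in> {1..n}" "{p j, p l} = {x, x + 1}" using col by (auto simp: collides_def)
    have inj: "inj_on p {1..n}" using st unfolding valid_state_def fst_conv by blast
    \<comment> \<open>Label \<open>l\<close> may be at the left or at the right site of the pair;
      either way the mark exchanges two labelled particles.\<close>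
    have g': "?g' = ?g"
    proof (cases "p j = x")
      case True
      then have "p l = x + 1" using j(2) by (auto simp: doubleton_eq_iff)
      with True show ?thesis by (intro config_weight_exchange[OF j(1) l inj])
    next
      case False
      then have "p l = x" "p j = x + 1" using j(2) by (auto simp: doubleton_eq_iff)
      then show ?thesis by (intro config_weight_exchange[OF l j(1) inj])
    qed
    have "cosh (\<beta> * of_int ?T) + cosh (\<beta> * of_int ?F) \<le> cosh (\<beta> * of_int (?D + d)) + cosh (\<beta> * of_int (?D - d))"
      unfolding d(2) using cosh_mult_mono_abs[OF d(3)] by simp
    also have "\<dots> = 2 * cosh (\<beta> * of_int ?D) * cosh (\<beta> * of_int d)"
      using cosh_add_plus_cosh_diff[of "\<beta> * of_int ?D" "\<beta> * of_int d"]
      by (simp only: of_int_add[of ?D d] of_int_diff[of ?D d] distrib_left right_diff_distrib)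
    also have "cosh (\<beta> * of_int d) = cosh \<beta>"
    proof -
      have "d = 1 \<or> d = -1" using d(1) by linarith
      then show ?thesis by auto
    qed
    finally have "(cosh (\<beta> * of_int ?T) + cosh (\<beta> * of_int ?F)) * ?g \<le> 2 * cosh (\<beta> * of_int ?D) * cosh \<beta> * ?g"
      using g by (intro mult_right_mono)
    then show ?thesis
      unfolding VT VF g' using col by (simp add: algebra_simps)
  qed
qed

lemma lyapunov_step_wall:
  assumes x: "x = - int N - 1 \<or> x = int N" and st: "valid_state N n (p, q)" and l: "l \<in> {1..n}" and \<gamma>: "0 \<le> \<gamma>"
  shows "lyapunov N n \<theta> \<gamma> \<beta> l (mark_step N n \<sigma> x a (p, q)) \<le> lyapunov N n \<theta> \<gamma> \<beta> l (p, q)"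
proof -
  have "\<not> (a \<and> inLam N x \<and> inLam N (x + 1))" using x by (auto simp: inLam_def)
  then have f: "fst (mark_step N n \<sigma> x a (p, q)) = p" unfolding fst_mark_step by (rule if_not_P)
  have "0 \<le> config_weight N n \<theta> \<gamma> p" using config_weight_ge_1[OF \<gamma>] by (meson order_trans zero_le_one)
  then show ?thesis
    unfolding lyapunov_def f fst_conv
    by (intro mult_right_mono cosh_mult_mono_abs)
       (use discrepancy_mark_step_wall[OF x st l, of \<sigma> a] in \<open>simp_all add: discrepancy_def\<close>)
qed

text \<open>The coin halves the generator of the weight, so exp(-2) \<theta> is available per
  ordered adjacent pair. The hypothesis on \<beta> says that the excess due to collisions, with the
  weight at its maximum, does not exceed this amount.\<close>

lemma lyapunov_generator:
  assumes N: "1 \<le> N" and l: "l \<in> {1..n}" and st: "valid_state N n st" and \<theta>: "0 < \<theta>" "\<theta> \<le> 1"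
    and \<gamma>: "0 \<le> \<gamma>" "1 \<le> \<gamma> * (1 - exp (- \<theta> * N))"
    and \<beta>: "(cosh \<beta> - 1) * (1 + (real n)\<^sup>2 * (1 + 4 * \<gamma>)) \<le> exp (- 2) * \<theta>"
  shows "(\<Sum>x\<in>{- int N - 1..int N}. (lyapunov N n \<theta> \<gamma> \<beta> l (mark_step N n \<sigma> x True st) + lyapunov N n \<theta> \<gamma> \<beta> l (mark_step N n \<sigma> x False st)) / 2)
    \<le> (real (card {- int N - 1..int N}) + (real n)\<^sup>2 * (2 + 4 * \<gamma>) * \<theta>\<^sup>2) * lyapunov N n \<theta> \<gamma> \<beta> l st"
proof -
  obtain p q where pq: "st = (p, q)" by (rule prod.exhaust)
  note st = st[unfolded pq]
  have p: "\<forall>i\<in>{1..n}. inLam N (p i)" "inj_on p {1..n}"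
    using st unfolding valid_state_def fst_conv by blast+
  let ?X = "{- int N..int N - 1}"
  let ?V = "\<lambda>x. (lyapunov N n \<theta> \<gamma> \<beta> l (mark_step N n \<sigma> x True (p, q)) + lyapunov N n \<theta> \<gamma> \<beta> l (mark_step N n \<sigma> x False (p, q))) / 2"
  let ?g = "config_weight N n \<theta> \<gamma> p" and ?g' = "\<lambda>x. config_weight N n \<theta> \<gamma> (\<lambda>i. site_swap x (p i))"
  let ?C = "cosh (\<beta> * of_int (p l - q l))" and ?S = "adjacent_pairs n p"
  have V: "lyapunov N n \<theta> \<gamma> \<beta> l (p, q) = ?C * ?g" by (simp add: lyapunov_def discrepancy_def)
  have g: "1 \<le> ?g" "?g \<le> 1 + (real n)\<^sup>2 * (1 + 4 * \<gamma>)"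
    using config_weight_bounds[OF p(1)] \<theta> \<gamma> by simp_all
  have C: "0 \<le> ?C" by (rule cosh_real_nonneg)
  have S: "0 \<le> ?S" unfolding adjacent_pairs_def by (simp add: sum_nonneg case_prod_beta)
  have wall: "?V x \<le> ?C * ?g" if "x = - int N - 1 \<or> x = int N" for x
    using add_mono[OF lyapunov_step_wall[OF that st l \<gamma>(1), of \<theta> \<beta> \<sigma> True]
        lyapunov_step_wall[OF that st l \<gamma>(1), of \<theta> \<beta> \<sigma> False]]
    unfolding V by (simp only: mult_2[symmetric] divide_le_eq_numeral1 mult.commute[of _ 2])
  have "(\<Sum>x\<in>?X. ?V x) \<le> (\<Sum>x\<in>?X. ?C * ((?g' x + ?g) / 2 + (cosh \<beta> - 1) * ?g * of_bool (collides n p l x)))"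
    by (intro sum_mono lyapunov_step_interior st l \<gamma>) (auto simp: inLam_def)
  also have "\<dots> = ?C * ((\<Sum>x\<in>?X. ?g' x - ?g) / 2 + 2 * real N * ?g + (cosh \<beta> - 1) * ?g * (\<Sum>x\<in>?X. of_bool (collides n p l x)))"
  proof -
    have "(\<Sum>x\<in>?X. (?g' x + ?g) / 2 + (cosh \<beta> - 1) * ?g * of_bool (collides n p l x)) =
       (\<Sum>x\<in>?X. (?g' x - ?g) / 2 + ?g + (cosh \<beta> - 1) * ?g * of_bool (collides n p l x))"
      by (intro sum.cong refl) (simp add: field_simps)
    also have "\<dots> = (\<Sum>x\<in>?X. ?g' x - ?g) / 2 + 2 * real N * ?g + (cosh \<beta> - 1) * ?g * (\<Sum>x\<in>?X. of_bool (collides n p l x))"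
      unfolding sum.distrib sum_divide_distrib[symmetric] sum_distrib_left[symmetric] by simp
    finally show ?thesis unfolding sum_distrib_left[symmetric] by (rule arg_cong)
  qed
  also have "\<dots> \<le> ?C * ((real n)\<^sup>2 * (2 + 4 * \<gamma>) * \<theta>\<^sup>2 + 2 * real N * ?g)"
  proof (intro mult_left_mono C)
    have "(cosh \<beta> - 1) * ?g * (\<Sum>x\<in>?X. of_bool (collides n p l x)) \<le> (exp (- 2) * \<theta>) * ?S"
    proof (rule mult_mono)
      have "(cosh \<beta> - 1) * ?g \<le> (cosh \<beta> - 1) * (1 + (real n)\<^sup>2 * (1 + 4 * \<gamma>))"
        using g cosh_real_ge_1[of \<beta>] by (intro mult_left_mono) auto
      with \<beta> show "(cosh \<beta> - 1) * ?g \<le> exp (- 2) * \<theta>" by linarith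
    qed (use sum_collides_le[OF l, of ?X p] \<theta> in \<open>auto intro: sum_nonneg\<close>)
    moreover have "(\<Sum>x\<in>?X. ?g' x - ?g) \<le> (real n)\<^sup>2 * (4 + 8 * \<gamma>) * \<theta>\<^sup>2 - 2 * exp (- 2) * \<theta> * ?S"
      by (rule sum_site_swap_config_weight[OF N p \<theta> \<gamma>])
    moreover have "(real n)\<^sup>2 * (4 + 8 * \<gamma>) * \<theta>\<^sup>2 = 2 * ((real n)\<^sup>2 * (2 + 4 * \<gamma>) * \<theta>\<^sup>2)" by (simp add: algebra_simps)
    ultimately show "(\<Sum>x\<in>?X. ?g' x - ?g) / 2 + 2 * real N * ?g + (cosh \<beta> - 1) * ?g * (\<Sum>x\<in>?X. of_bool (collides n p l x))
      \<le> (real n)\<^sup>2 * (2 + 4 * \<gamma>) * \<theta>\<^sup>2 + 2 * real N * ?g"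
      by linarith
  qed
  also have "\<dots> \<le> ?C * ((real n)\<^sup>2 * (2 + 4 * \<gamma>) * \<theta>\<^sup>2 * ?g + 2 * real N * ?g)"
    using mult_left_mono[OF g(1), of "(real n)\<^sup>2 * (2 + 4 * \<gamma>) * \<theta>\<^sup>2"] \<gamma>
    by (intro mult_left_mono C) simp
  finally have "(\<Sum>x\<in>?X. ?V x) \<le> ?C * ((real n)\<^sup>2 * (2 + 4 * \<gamma>) * \<theta>\<^sup>2 * ?g + 2 * real N * ?g)" .
  \<comment> \<open>The 2N inner pairs and the two outer ones give the 2N + 2 terms counted by
    \<open>card\<close>; a mark at an outer pair does not increase the function.\<close>
  moreover have "{- int N - 1..int N} = insert (- int N - 1) (insert (int N) ?X)" by auto
  then have "(\<Sum>x\<in>{- int N - 1..int N}. ?V x) = ?V (- int N - 1) + (?V (int N) + (\<Sum>x\<in>?X. ?V x))"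
    by (simp only:) (subst sum.insert; simp)+
  ultimately have "(\<Sum>x\<in>{- int N - 1..int N}. ?V x) \<le> ?C * ?g + (?C * ?g + ?C * ((real n)\<^sup>2 * (2 + 4 * \<gamma>) * \<theta>\<^sup>2 * ?g + 2 * real N * ?g))"
    using wall[of "- int N - 1"] wall[of "int N"] by linarith
  also have "\<dots> = (real (card {- int N - 1..int N}) + (real n)\<^sup>2 * (2 + 4 * \<gamma>) * \<theta>\<^sup>2) * (?C * ?g)"
    by (simp add: algebra_simps)
  finally show ?thesis unfolding pq V .
qed


section \<open>Markov's inequality and the choice of the constants\<close>

lemma power_le_fact_mult_exp:
  fixes x :: real
  assumes "0 \<le> x"
  shows "x ^ m \<le> fact m * exp x"
proof -
  have "(\<Sum>k\<in>{m}. x ^ k /\<^sub>R fact k) \<le> (\<Sum>k. x ^ k /\<^sub>R fact k)"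
    using assms summable_exp_generic[of x] by (intro sum_le_suminf) auto
  then show ?thesis by (simp add: exp_def field_simps)
qed

lemma cosh_minus_1_le:
  fixes x :: real
  assumes "0 < x" "x \<le> 1"
  shows "cosh x - 1 \<le> x\<^sup>2"
  using exp_second_difference(2)[OF assms] by (simp add: cosh_field_def field_simps)

definition discrepancy_event :: "nat \<Rightarrow> nat \<Rightarrow> (nat \<Rightarrow> nat) \<Rightarrow> (nat \<Rightarrow> int) \<Rightarrow> real \<Rightarrow> nat \<Rightarrow> real
    \<Rightarrow> (int \<Rightarrow> (real \<times> bool) stream) set" where
  "discrepancy_event N n \<sigma> z t l A = {\<omega> \<in> space (marks_space N). A \<le> of_int \<bar>discrepancy l (coupled_state N n \<sigma> z \<omega> t)\<bar>}"

lemma sets_discrepancy_event [measurable]: "discrepancy_event N n \<sigma> z t l A \<in> sets (marks_space N)"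
proof -
  let ?P = "\<lambda>L. A \<le> of_int \<bar>discrepancy l (fold (\<lambda>(x, a). mark_step N n \<sigma> x a) L (z, z))\<bar>"
  have "(\<lambda>\<omega>. mark_word N \<omega> t) -` {L. ?P L} \<inter> space (marks_space N) \<in> sets (marks_space N)"
    unfolding marks_space_env_space by (intro measurable_sets[OF measurable_mark_word]) simp
  also have "(\<lambda>\<omega>. mark_word N \<omega> t) -` {L. ?P L} \<inter> space (marks_space N) = discrepancy_event N n \<sigma> z t l A"
    by (auto simp: discrepancy_event_def coupled_state_mark_word)
  finally show ?thesis .
qed

text \<open>This is Markov's inequality for the cosh of the discrepancy, which the Lyapunov function
  dominates. Both processes start from \<open>z\<close>, so the initial cosh factor is one and only
  the maximum of the weight appears.\<close>

lemma measure_discrepancy_event_mult_cosh_le: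
  assumes N: "1 \<le> N" and t: "0 \<le> t" and l: "l \<in> {1..n}" and z: "inj_on z {1..n}" "\<forall>i\<in>{1..n}. inLam N (z i)"
    and \<theta>: "0 < \<theta>" "\<theta> \<le> 1" and \<gamma>: "0 \<le> \<gamma>" "1 \<le> \<gamma> * (1 - exp (- \<theta> * N))"
    and \<beta>: "0 \<le> \<beta>" "(cosh \<beta> - 1) * (1 + (real n)\<^sup>2 * (1 + 4 * \<gamma>)) \<le> exp (- 2) * \<theta>" and A: "0 \<le> A"
  shows "measure (marks_space N) (discrepancy_event N n \<sigma> z t l A) * cosh (\<beta> * A) \<le>
    exp ((real N)\<^sup>2 * ((real n)\<^sup>2 * (2 + 4 * \<gamma>) * \<theta>\<^sup>2) * t) * (1 + (real n)\<^sup>2 * (1 + 4 * \<gamma>))"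
proof -
  let ?E = "discrepancy_event N n \<sigma> z t l A" and ?V = "lyapunov N n \<theta> \<gamma> \<beta> l"
  let ?B = "exp ((real N)\<^sup>2 * ((real n)\<^sup>2 * (2 + 4 * \<gamma>) * \<theta>\<^sup>2) * t)"
  have r: "0 < (real N)\<^sup>2" using N by simp
  interpret P: prob_space "marks_space N"
    unfolding marks_space_env_space by (rule prob_space_env_space[OF r])
  have val: "valid_state N n (z, z)" using z by (simp add: valid_state_def)
  have "ennreal (cosh (\<beta> * A)) * emeasure (marks_space N) ?E = (\<integral>\<^sup>+\<omega>. ennreal (cosh (\<beta> * A)) * indicator ?E \<omega> \<partial>marks_space N)"
    by (simp add: nn_integral_cmult_indicator)
  also have "\<dots> \<le> (\<integral>\<^sup>+\<omega>. ennreal (?V (coupled_state N n \<sigma> z \<omega> t)) \<partial>marks_space N)"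
  proof (intro nn_integral_mono)
    fix \<omega>
    show "ennreal (cosh (\<beta> * A)) * indicator ?E \<omega> \<le> ennreal (?V (coupled_state N n \<sigma> z \<omega> t))"
    proof (cases "\<omega> \<in> ?E")
      case True
      let ?D = "discrepancy l (coupled_state N n \<sigma> z \<omega> t)"
      have "cosh (\<beta> * A) \<le> cosh (\<beta> * of_int \<bar>?D\<bar>)"
        using True \<beta>(1) A
        by (subst cosh_real_nonneg_le_iff) (auto simp: discrepancy_event_def intro!: mult_left_mono)
      also have "\<dots> \<le> cosh (\<beta> * of_int ?D)" by (rule cosh_mult_mono_abs) simp
      also have "\<dots> \<le> ?V (coupled_state N n \<sigma> z \<omega> t)" by (rule cosh_le_lyapunov[OF \<gamma>(1)])
      finally show ?thesis using True by (simp add: ennreal_leI)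
    qed simp
  qed
  also have "\<dots> \<le> ennreal (?B * ?V (z, z))"
    unfolding coupled_state_mark_word marks_space_env_space
    by (rule nn_integral_mark_word_le[where V = "?V" and Inv = "valid_state N n", OF r])
       (use t val \<gamma>(1) in \<open>auto intro!: lyapunov_nonneg valid_state_mark_step lyapunov_generator[OF N l _ \<theta> \<gamma> \<beta>(2)] simp del: card_atLeastAtMost_int\<close>)
  also have "?V (z, z) \<le> 1 + (real n)\<^sup>2 * (1 + 4 * \<gamma>)"
    using config_weight_bounds(2)[OF z(2), of \<theta> \<gamma>] \<theta> \<gamma> by (simp add: lyapunov_def discrepancy_def)
  then have "ennreal (?B * ?V (z, z)) \<le> ennreal (?B * (1 + (real n)\<^sup>2 * (1 + 4 * \<gamma>)))"
    by (intro ennreal_leI mult_left_mono) auto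
  finally have "ennreal (cosh (\<beta> * A) * measure (marks_space N) ?E) \<le> ennreal (?B * (1 + (real n)\<^sup>2 * (1 + 4 * \<gamma>)))"
    by (simp add: P.emeasure_eq_measure ennreal_mult')
  then show ?thesis
    using \<gamma>(1) by (subst (asm) ennreal_le_iff) (auto simp: mult.commute)
qed

theorem theorem4p5:
  fixes n :: nat and \<sigma> :: "nat \<Rightarrow> nat" and T :: real and \<zeta> :: real and k :: nat
  assumes "n \<ge> 1" and "\<sigma> permutes {1..n}" and "T > 0" and "\<zeta> > 0"
  shows "\<exists>c::real. \<forall>(N::nat) (t::real) (z::nat \<Rightarrow> int) (l::nat).
     N \<ge> 1 \<and> 0 < t \<and> t \<le> T \<and> l \<in> {1..n} \<and>
     inj_on z {1..n} \<and> (\<forall>i\<in>{1..n}. inLam N (z i)) \<longrightarrow>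
     (let E = {\<omega> \<in> space (marks_space N).
                 \<bar>fst (coupled_state N n \<sigma> z \<omega> t) l - snd (coupled_state N n \<sigma> z \<omega> t) l\<bar>
                   \<ge> (real N ^ 2 * t) powr (1/4 + \<zeta>)}
      in E \<in> sets (marks_space N) \<and>
         measure (marks_space N) E \<le> c * (real N ^ 2 * t) powr (- real k))"
proof -
  \<comment> \<open>The smallest value for which \<theta>N \<ge> 1/sqrt T guarantees the lower bound
    required of \<gamma>.\<close>
  define \<gamma> where "\<gamma> = 1 / (1 - exp (- (1 / sqrt T)))"
  define K where "K = 1 + (real n)\<^sup>2 * (1 + 4 * \<gamma>)"
  \<comment> \<open>Solves b^2 K = exp(-2). With cosh \<beta> - 1 \<le> \<beta>^2 and \<beta>^2 =
    b^2 \<theta>, this meets the condition on \<beta>.\<close>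
  define b where "b = sqrt (exp (- 2) / K)"
  \<comment> \<open>Chosen so that m\<zeta> \<ge> k: the m-th power of \<tau>^\<zeta> then dominates
    \<tau>^k for \<tau> \<ge> 1.\<close>
  define m where "m = nat \<lceil>real k / \<zeta>\<rceil>"
  define B where "B = exp ((real n)\<^sup>2 * (2 + 4 * \<gamma>)) * K"
  define c where "c = 1 + B * (2 * fact m) / b ^ m"
  have e1: "exp (- (1 / sqrt T)) < 1" using \<open>T > 0\<close> by simp
  then have \<gamma>0: "0 < \<gamma>" by (simp add: \<gamma>_def)
  then have K: "1 \<le> K" by (simp add: K_def)
  have b: "0 < b" "b \<le> 1" "b\<^sup>2 * K = exp (- 2)"
  proof -
    have "exp (- 2) \<le> (1 :: real)" by simp
    then show "0 < b" "b \<le> 1" "b\<^sup>2 * K = exp (- 2)"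
      using K by (simp_all add: b_def divide_le_eq del: exp_le_one_iff)
  qed
  have B: "0 < B" using K by (simp add: B_def)
  have c: "1 \<le> c" using B b by (simp add: c_def)
  have m: "real k \<le> \<zeta> * real m"
  proof -
    have "real k / \<zeta> \<le> real m" unfolding m_def using \<open>\<zeta> > 0\<close> by linarith
    then show ?thesis using \<open>\<zeta> > 0\<close> by (simp add: field_simps)
  qed
  have bound: "measure (marks_space N) (discrepancy_event N n \<sigma> z t l (((real N)\<^sup>2 * t) powr (1/4 + \<zeta>)))
      \<le> c * ((real N)\<^sup>2 * t) powr (- real k)"
    if N: "N \<ge> 1" and t: "0 < t" "t \<le> T" and l: "l \<in> {1..n}" and z: "inj_on z {1..n}" "\<forall>i\<in>{1..n}. inLam N (z i)"
    for N t z l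
  proof -
    define \<tau> where "\<tau> = (real N)\<^sup>2 * t"
    have \<tau>0: "0 < \<tau>" using N t by (simp add: \<tau>_def)
    interpret P: prob_space "marks_space N"
      unfolding marks_space_env_space using N by (intro prob_space_env_space) simp
    let ?p = "measure (marks_space N) (discrepancy_event N n \<sigma> z t l (\<tau> powr (1/4 + \<zeta>)))"
    have "?p \<le> c * \<tau> powr (- real k)"
    \<comment> \<open>For \<tau> < 1 the right side is at least one, thanks to the summand 1 in
      \<open>c\<close>. The other case supplies \<theta> \<le> 1 and \<beta> \<le> 1.\<close>
    proof (cases "\<tau> < 1")
      case True
      then have "1 powr (- real k) \<le> \<tau> powr (- real k)"
        using \<tau>0 by (intro powr_mono2') auto
      then have "1 * 1 \<le> c * \<tau> powr (- real k)" using c by (intro mult_mono) auto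
      then have "1 \<le> c * \<tau> powr (- real k)" by simp
      then show ?thesis by (rule order_trans[OF P.prob_le_1])
    next
      case False
      define \<theta> where "\<theta> = \<tau> powr (- (1/2))"
      define \<beta> where "\<beta> = b * \<tau> powr (- (1/4))"
      have \<theta>: "0 < \<theta>" "\<theta> \<le> 1" "\<theta>\<^sup>2 * \<tau> = 1"
      proof -
        show "0 < \<theta>" using \<tau>0 by (simp add: \<theta>_def)
        have "\<tau> powr (- (1/2)) \<le> 1 powr (- (1/2))" using False by (intro powr_mono2') auto
        then show "\<theta> \<le> 1" by (simp add: \<theta>_def)
        show "\<theta>\<^sup>2 * \<tau> = 1"
        proof -
          have "\<theta>\<^sup>2 = \<tau> powr (- 1)"
            by (simp add: \<theta>_def power2_eq_square powr_add[symmetric])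
          then show ?thesis using \<tau>0 by (simp add: powr_minus)
        qed
      qed
      have \<theta>N: "1 \<le> \<gamma> * (1 - exp (- \<theta> * N))"
      proof -
        have "\<theta> = 1 / (real N * sqrt t)"
          using N t by (simp add: \<theta>_def \<tau>_def powr_minus powr_half_sqrt real_sqrt_mult field_simps)
        then have "\<theta> * N = 1 / sqrt t" using N by simp
        also have "\<dots> \<ge> 1 / sqrt T" using t by (intro divide_left_mono) auto
        finally have "exp (- \<theta> * N) \<le> exp (- (1 / sqrt T))" by simp
        then have "1 - exp (- (1 / sqrt T)) \<le> 1 - exp (- \<theta> * N)" by simp
        then have "\<gamma> * (1 - exp (- (1 / sqrt T))) \<le> \<gamma> * (1 - exp (- \<theta> * N))"
          using \<gamma>0 by (intro mult_left_mono) auto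
        moreover have "\<gamma> * (1 - exp (- (1 / sqrt T))) = 1" using e1 by (simp add: \<gamma>_def)
        ultimately show ?thesis by simp
      qed
      have \<beta>: "0 < \<beta>" "\<beta> \<le> 1" "\<beta>\<^sup>2 = b\<^sup>2 * \<theta>"
      proof -
        show "0 < \<beta>" using b \<tau>0 by (simp add: \<beta>_def)
        have "\<tau> powr (- (1/4)) \<le> 1 powr (- (1/4))" using False by (intro powr_mono2') auto
        then have "b * \<tau> powr (- (1/4)) \<le> 1 * 1" using b by (intro mult_mono) auto
        then show "\<beta> \<le> 1" by (simp add: \<beta>_def)
        show "\<beta>\<^sup>2 = b\<^sup>2 * \<theta>"
          using \<tau>0 by (simp add: \<beta>_def \<theta>_def power_mult_distrib powr_power)
      qed
      have "(cosh \<beta> - 1) * K \<le> \<beta>\<^sup>2 * K"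
        using cosh_minus_1_le[OF \<beta>(1,2)] K by (intro mult_right_mono) auto
      also have "\<dots> = exp (- 2) * \<theta>"
        unfolding \<beta>(3) b(3)[symmetric] by (simp add: mult_ac)
      finally have "?p * cosh (\<beta> * \<tau> powr (1/4 + \<zeta>)) \<le>
          exp ((real N)\<^sup>2 * ((real n)\<^sup>2 * (2 + 4 * \<gamma>) * \<theta>\<^sup>2) * t) * K"
        unfolding K_def using t \<gamma>0 \<beta>(1)
        by (intro measure_discrepancy_event_mult_cosh_le N l z \<theta> \<theta>N) auto
      also have "(real N)\<^sup>2 * ((real n)\<^sup>2 * (2 + 4 * \<gamma>) * \<theta>\<^sup>2) * t = (real n)\<^sup>2 * (2 + 4 * \<gamma>) * (\<theta>\<^sup>2 * \<tau>)"
        by (simp add: \<tau>_def mult_ac)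
      finally have main: "?p * cosh (\<beta> * \<tau> powr (1/4 + \<zeta>)) \<le> B"
        by (simp add: \<theta>(3) B_def)
      \<comment> \<open>The power -1/4 in \<beta> cancels the 1/4 of the threshold, leaving a
        stretched exponential in \<tau>^\<zeta>. One term of the exponential series then gives the
        required power of \<tau>.\<close>
      have bA: "\<beta> * \<tau> powr (1/4 + \<zeta>) = b * \<tau> powr \<zeta>"
        by (simp add: \<beta>_def powr_add[symmetric])
      have "b ^ m * \<tau> powr real k \<le> b ^ m * \<tau> powr (\<zeta> * real m)"
        using False b m by (intro mult_left_mono powr_mono) auto
      also have "\<dots> = (b * \<tau> powr \<zeta>) ^ m"
        using \<tau>0 by (simp add: power_mult_distrib powr_power mult.commute)
      also have "\<dots> \<le> fact m * exp (b * \<tau> powr \<zeta>)"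
        using b by (intro power_le_fact_mult_exp) auto
      also have "\<dots> \<le> fact m * (2 * cosh (b * \<tau> powr \<zeta>))"
        by (intro mult_left_mono) (auto simp: cosh_field_def)
      finally have "?p * (b ^ m * \<tau> powr real k) \<le> ?p * (fact m * (2 * cosh (b * \<tau> powr \<zeta>)))"
        by (intro mult_left_mono) auto
      also have "\<dots> = 2 * fact m * (?p * cosh (\<beta> * \<tau> powr (1/4 + \<zeta>)))"
        unfolding bA by (simp add: mult_ac)
      also have "\<dots> \<le> 2 * fact m * B"
        by (intro mult_left_mono main) auto
      finally have "?p * (b ^ m * \<tau> powr real k) \<le> 2 * fact m * B" .
      moreover have "0 < b ^ m * \<tau> powr real k" using b \<tau>0 by simp
      ultimately have "?p \<le> 2 * fact m * B / (b ^ m * \<tau> powr real k)"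
        by (simp only: pos_le_divide_eq)
      also have "\<dots> = B * (2 * fact m) / b ^ m * \<tau> powr (- real k)"
        by (simp add: powr_minus divide_inverse mult_ac)
      also have "\<dots> \<le> c * \<tau> powr (- real k)"
        by (intro mult_right_mono) (auto simp: c_def)
      finally show ?thesis .
    qed
    then show ?thesis by (simp add: \<tau>_def)
  qed
  have event: "{\<omega> \<in> space (marks_space N).
       \<bar>fst (coupled_state N n \<sigma> z \<omega> t) l - snd (coupled_state N n \<sigma> z \<omega> t) l\<bar> \<ge> A} = discrepancy_event N n \<sigma> z t l A"
    for N t z l and A :: real
    by (simp add: discrepancy_event_def discrepancy_def)
  show ?thesis
    unfolding Let_def event using bound by (intro exI[of _ c]) simp
qed

end
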